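(* Let $\gamma\in(0,1)$ and $\alpha\in\mathbb{R}$. The assignment $$\hat\Lambda^{\mathrm q}_{S,\gamma,\alpha}:Z\hat C^{\gamma}(\Delta_T^3;B_\alpha)\to\mathfrak Q^{\gamma,\alpha}_{\mathrm{fr}},\qquad h\mapsto\hat\Lambda^{\mathrm q}_{S,\gamma,\alpha}h,\qquad\bigl(\hat\Lambda^{\mathrm q}_{S,\gamma,\alpha}h\bigr)^\tau:=[r^\tau_{\mathrm d}(h)]_\tau,$$ is a well-defined continuous linear map such that (1) for every $\tau\in[0,T]$ and every representative $r^\tau\in(\hat\Lambda^{\mathrm q}_{S,\gamma,\alpha}h)^\tau$, $\delta r^\tau=h^\tau$; (2) in particular, for every $0\le s\le u\le t\le T$ and every representative $r^t\in(\hat\Lambda^{\mathrm q}_{S,\gamma,\alpha}h)^t$, $(\delta r^t)_{tus}=h_{tus}$; (3) for every $h\in Z\hat C^{\gamma}(\Delta_T^3;B_\alpha)$, the uniform estimate $\|\hat\Lambda^{\mathrm q}_{S,\gamma,\alpha}h\|_{\mathfrak Q^{\gamma,\alpha}_{\mathrm{fr}}}\le C_{\gamma,T}M_{\alpha,T}\|h\|_{\gamma,\alpha}$ holds, with $C_{\gamma,T}$ independent of $h$.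
   Context: Fix $T>0$. $(B_\alpha)_{\alpha\in\mathbb{R}}$ is a Banach scale, i.e. a family of Banach spaces such that for $\alpha\le\beta$ the embedding $B_\beta\hookrightarrow B_\alpha$ is continuous. $S=(S_t)_{t\ge0}$ is an analytic (in particular strongly continuous) semigroup of bounded linear operators acting on this scale, with $S_0=\mathrm{Id}$; for every $\alpha\in\mathbb{R}$, $\varepsilon\in(0,1)$ there is $C_{\alpha,\varepsilon,T}>0$ with $\|S_tx\|_{B_{\alpha+\varepsilon}}\le C_{\alpha,\varepsilon,T}t^{-\varepsilon}\|x\|_{B_\alpha}$ and $\|(S_t-\mathrm{Id})x\|_{B_\alpha}\le C_{\alpha,\varepsilon,T}t^{\varepsilon}\|x\|_{B_{\alpha+\varepsilon}}$ for all $t\in(0,T]$. $M_{\alpha,T}:=\sup_{0\le r\le T}\|S_r\|_{\mathcal L(B_\alpha,B_\alpha)}<\infty$. For $\tau\in[0,T]$, $\Delta_\tau^n:=\{(t_1,\dots,t_n)\in[0,\tau]^n:0\le t_n\le\dots\le t_1\le\tau\}$; $C(\Delta_\tau^n;B_\alpha)$ denotes continuous maps; $(\delta g)_{t_1\dots t_{n+1}}:=\sum_{i=1}^{n+1}(-1)^ig_{t_1\dots\hat t_i\dots t_{n+1}}$ (for a path, $(\delta I)_{ts}=I_t-I_s$); on $C(\Delta_T^n;B_\alpha)$, $(\hat\delta g)_{t_1\dots t_{n+1}}:=(\delta g)_{t_1\dots t_{n+1}}-(S_{t_1-t_2}-\mathrm{Id})g_{t_2\dots t_{n+1}}$. Norms: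 for $g\in C(\Delta_\tau^2;B_\alpha)$, $\|g\|_{\mu,\alpha;\tau}:=\sup_{0\le s<t\le\tau}\|g_{ts}\|_{B_\alpha}/|t-s|^\mu$, and $C^\mu(\Delta_\tau^2;B_\alpha)$ is the subset of $C(\Delta_\tau^2;B_\alpha)$ where it is finite. For $h\in C(\Delta_\tau^3;B_\alpha)$, $\|h\|_{\mu,\alpha;\tau}:=\inf\{\sum_{j=1}^m\sup_{0\le s<u<t\le\tau}\frac{\|h_{j,tus}\|_{B_\alpha}}{|t-u|^{\rho_j}|u-s|^{\mu-\rho_j}}:h=\sum_{j=1}^mh_j,\ m\in\mathbb{N},\ 0<\rho_j<\mu\}$; $C^\mu(\Delta_\tau^3;B_\alpha)$ is the set where it is finite; the index $\tau$ is dropped when $\tau=T$. $ZC^\mu(\Delta_\tau^3;B_\alpha):=\ker(\delta)\cap C^\mu(\Delta_\tau^3;B_\alpha)$, $Z\hat C^\mu(\Delta_T^3;B_\alpha):=\ker(\hat\delta)\cap C^\mu(\Delta_T^3;B_\alpha)$. Dyadic frozen increments: let $\mathcal A^\gamma(\Delta_\tau^2;B_\alpha):=\{A\in C(\Delta_\tau^2;B_\alpha):\delta A\in C^\gamma(\Delta_\tau^3;B_\alpha)\}$. Fix, for each $\tau$, a linear map $\mathcal I^{\mathrm d}_\tau:\mathcal A^\gamma(\Delta_\tau^2;B_\alpha)\to C([0,\tau];B_\alpha)$ (the normalized dyadic ordinary low-regularity sewing map, obtained from a dyadic recursion on $\bigcup_n\{k2^{-n}\tau:0\le k\le2^n\}$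 and continuous extension; such maps exist) such that for every $A$: $\mathcal I^{\mathrm d}_\tau(A)_0=0$, and $\mathcal R^{\mathrm d}_\tau(A):=A-\delta\mathcal I^{\mathrm d}_\tau(A)$ satisfies $\delta\mathcal R^{\mathrm d}_\tau(A)=\delta A$, $\mathcal R^{\mathrm d}_\tau(A)\in C^\gamma(\Delta_\tau^2;B_\alpha)$ and $\|\mathcal R^{\mathrm d}_\tau(A)\|_{\gamma,\alpha;\tau}\le C_\gamma\|\delta A\|_{\gamma,\alpha;\tau}$, with $C_\gamma$ independent of $\tau$. For $k\in ZC^\gamma(\Delta_\tau^3;B_\alpha)$ set $b^k_{ts}:=-k_{ts0}$ and $\Lambda^{\mathrm d}_\tau k:=\mathcal R^{\mathrm d}_\tau(b^k)$. For $h\in Z\hat C^\gamma(\Delta_T^3;B_\alpha)$ let $h^\tau_{tus}:=S_{\tau-t}h_{tus}$ on $\Delta_\tau^3$ (it lies in $ZC^\gamma(\Delta_\tau^3;B_\alpha)$) and $r^\tau_{\mathrm d}(h):=\Lambda^{\mathrm d}_\tau(h^\tau)$. Quotients: $ZC(\Delta_\tau^2;B_\alpha):=\ker(\delta)\cap C(\Delta_\tau^2;B_\alpha)$; for $r\in C(\Delta_\tau^2;B_\alpha)$, $[r]_\tau$ is its class modulo $ZC(\Delta_\tau^2;B_\alpha)$. $\mathfrak C^\gamma(\Delta_\tau^2;B_\alpha):=\{[r]_\tau:[r]_\tau\cap C^\gamma(\Delta_\tau^2;B_\alpha)\ne\varnothing\}$ with seminorm $\|[r]_\tau\|_{\mathfrak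 C_2^{\gamma,\alpha}(\tau)}:=\inf\{\|\widetilde r\|_{\gamma,\alpha;\tau}:\widetilde r\in[r]_\tau\cap C^\gamma(\Delta_\tau^2;B_\alpha)\}$. For $0\le\tau'\le\tau\le T$: $\operatorname{Res}_{\tau,\tau'}[r]_\tau:=[r|_{\Delta_{\tau'}^2}]_{\tau'}$ and $\mathcal T_{\tau,\tau'}[q]_{\tau'}:=[S_{\tau-\tau'}q]_{\tau'}$. $\mathfrak Q^{\gamma,\alpha}_{\mathrm{fr}}$ is the vector space of families $\mathfrak r=(\mathfrak r^\tau)_{\tau\in[0,T]}$ with $\mathfrak r^\tau\in\mathfrak C^\gamma(\Delta_\tau^2;B_\alpha)$, $\operatorname{Res}_{\tau,\tau'}\mathfrak r^\tau=\mathcal T_{\tau,\tau'}\mathfrak r^{\tau'}$ for all $0\le\tau'\le\tau\le T$, and $\|\mathfrak r\|_{\mathfrak Q^{\gamma,\alpha}_{\mathrm{fr}}}:=\sup_{\tau\in[0,T]}\|\mathfrak r^\tau\|_{\mathfrak C_2^{\gamma,\alpha}(\tau)}<\infty$. *)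

theory Defs
  imports "HOL-Analysis.Analysis"
begin

section \<open>Banach scales and analytic semigroups\<close>

text \<open>
  The spaces of a scale are indexed by real numbers, so they are given as normed subspaces
  of one ambient real vector space; the embeddings of the scale are then inclusions.
  The norm is only meaningful on the underlying set of vectors.
\<close>

datatype 'a nspace = NSpace (vecs: "'a set") (nrm: "'a \<Rightarrow> real")

definition banach_space :: "'a::real_vector nspace \<Rightarrow> bool" where
  "banach_space X \<longleftrightarrow>
     subspace (vecs X) \<and>
     (\<forall>x\<in>vecs X. 0 \<le> nrm X x \<and> (nrm X x = 0 \<longleftrightarrow> x = 0)) \<and>
     (\<forall>x\<in>vecs X. \<forall>c. nrm X (c *\<^sub>R x) = \<bar>c\<bar> * nrm X x) \<and>
     (\<forall>x\<in>vecs X. \<forall>y\<in>vecs X. nrm X (x + y) \<le> nrm X x + nrm X y) \<and>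
     (\<forall>f :: nat \<Rightarrow> 'a.
        (\<forall>n. f n \<in> vecs X) \<and> (\<forall>e>0. \<exists>n\<^sub>0. \<forall>m\<ge>n\<^sub>0. \<forall>n\<ge>n\<^sub>0. nrm X (f m - f n) < e) \<longrightarrow>
        (\<exists>l\<in>vecs X. (\<lambda>n. nrm X (f n - l)) \<longlonglongrightarrow> 0))"

definition linear_on_vecs :: "'a::real_vector set \<Rightarrow> ('a \<Rightarrow> 'b::real_vector) \<Rightarrow> bool" where
  "linear_on_vecs V A \<longleftrightarrow>
     (\<forall>x\<in>V. \<forall>y\<in>V. A (x + y) = A x + A y) \<and> (\<forall>c. \<forall>x\<in>V. A (c *\<^sub>R x) = c *\<^sub>R A x)"

definition bounded_op :: "'a::real_vector nspace \<Rightarrow> ('a \<Rightarrow> 'a) \<Rightarrow> bool" where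
  "bounded_op X A \<longleftrightarrow>
     A ` vecs X \<subseteq> vecs X \<and> linear_on_vecs (vecs X) A \<and>
     (\<exists>K. \<forall>x\<in>vecs X. nrm X (A x) \<le> K * nrm X x)"

definition op_norm :: "'a::real_vector nspace \<Rightarrow> ('a \<Rightarrow> 'a) \<Rightarrow> real" where
  "op_norm X A = (SUP x\<in>{x \<in> vecs X. nrm X x \<le> 1}. nrm X (A x))"

definition c0_semigroup :: "'a::real_vector nspace \<Rightarrow> (real \<Rightarrow> 'a \<Rightarrow> 'a) \<Rightarrow> bool" where
  "c0_semigroup X S \<longleftrightarrow>
     (\<forall>t\<ge>0. bounded_op X (S t)) \<and>
     (\<forall>x\<in>vecs X. S 0 x = x) \<and>
     (\<forall>s\<ge>0. \<forall>t\<ge>0. \<forall>x\<in>vecs X. S (s + t) x = S s (S t x)) \<and>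
     (\<forall>x\<in>vecs X. \<forall>t\<ge>0. ((\<lambda>s. nrm X (S s x - S t x)) \<longlongrightarrow> 0) (at t within {0..}))"

text \<open>
  The complexification: \<open>(x, y)\<close> stands for \<open>x + i y\<close>. Its norm is only real-homogeneous,
  but it is equivalent to a complex norm, and only the topology is used below.
\<close>

definition complexify :: "'a::real_vector nspace \<Rightarrow> ('a \<times> 'a) nspace" where
  "complexify X = NSpace (vecs X \<times> vecs X) (\<lambda>w. nrm X (fst w) + nrm X (snd w))"

definition cmul :: "complex \<Rightarrow> 'a::real_vector \<times> 'a \<Rightarrow> 'a \<times> 'a" where
  "cmul c w = (Re c *\<^sub>R fst w - Im c *\<^sub>R snd w, Re c *\<^sub>R snd w + Im c *\<^sub>R fst w)"

definition sector :: "real \<Rightarrow> complex set" where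
  "sector \<theta> = {z. z \<noteq> 0 \<and> \<bar>Arg z\<bar> < \<theta>}"

text \<open>
  A strongly continuous semigroup on a real Banach space is analytic if its complexification
  extends to a holomorphic semigroup on an open sector, strongly continuous at 0 in every
  smaller sector.
\<close>

definition analytic_semigroup :: "'a::real_vector nspace \<Rightarrow> (real \<Rightarrow> 'a \<Rightarrow> 'a) \<Rightarrow> bool" where
  "analytic_semigroup X S \<longleftrightarrow> c0_semigroup X S \<and>
     (\<exists>\<theta> (P :: complex \<Rightarrow> 'a \<times> 'a \<Rightarrow> 'a \<times> 'a). 0 < \<theta> \<and> \<theta> \<le> pi / 2 \<and>
        (\<forall>z\<in>sector \<theta>. bounded_op (complexify X) (P z) \<and>
           (\<forall>w\<in>vecs (complexify X). \<forall>c. P z (cmul c w) = cmul c (P z w))) \<and>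
        (\<forall>t>0. \<forall>x\<in>vecs X. \<forall>y\<in>vecs X. P (complex_of_real t) (x, y) = (S t x, S t y)) \<and>
        (\<forall>z\<in>sector \<theta>. \<forall>z'\<in>sector \<theta>. \<forall>w\<in>vecs (complexify X). P (z + z') w = P z (P z' w)) \<and>
        (\<forall>z\<in>sector \<theta>. \<forall>w\<in>vecs (complexify X). \<exists>d\<in>vecs (complexify X).
           ((\<lambda>z'. nrm (complexify X) (cmul (inverse (z' - z)) (P z' w - P z w) - d)) \<longlongrightarrow> 0) (at z)) \<and>
        (\<forall>\<theta>'. 0 < \<theta>' \<and> \<theta>' < \<theta> \<longrightarrow> (\<forall>w\<in>vecs (complexify X).
           ((\<lambda>z. nrm (complexify X) (P z w - w)) \<longlongrightarrow> 0) (at 0 within sector \<theta>'))))"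

locale analytic_scale =
  fixes T :: real
    and B :: "real \<Rightarrow> 'a::real_vector nspace"
    and S :: "real \<Rightarrow> 'a \<Rightarrow> 'a"
  assumes banach: "\<And>\<alpha>. banach_space (B \<alpha>)"
    and embedding: "\<And>\<alpha> \<beta>. \<alpha> \<le> \<beta> \<Longrightarrow> vecs (B \<beta>) \<subseteq> vecs (B \<alpha>) \<and>
          (\<exists>C. \<forall>x\<in>vecs (B \<beta>). nrm (B \<alpha>) x \<le> C * nrm (B \<beta>) x)"
    and analytic: "\<And>\<alpha>. analytic_semigroup (B \<alpha>) S"
    and smoothing: "\<And>\<alpha> \<epsilon>. 0 < \<epsilon> \<Longrightarrow> \<epsilon> < 1 \<Longrightarrow> \<exists>C>0. \<forall>t\<in>{0<..T}.
          (\<forall>x\<in>vecs (B \<alpha>). S t x \<in> vecs (B (\<alpha> + \<epsilon>)) \<and>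
             nrm (B (\<alpha> + \<epsilon>)) (S t x) \<le> C * t powr (- \<epsilon>) * nrm (B \<alpha>) x) \<and>
          (\<forall>x\<in>vecs (B (\<alpha> + \<epsilon>)).
             nrm (B \<alpha>) (S t x - x) \<le> C * t powr \<epsilon> * nrm (B (\<alpha> + \<epsilon>)) x)"
    and semigroup_bound_finite: "\<And>\<alpha>. bdd_above ((\<lambda>r. op_norm (B \<alpha>) (S r)) ` {0..T})"

definition semigroup_bound :: "real \<Rightarrow> 'a::real_vector nspace \<Rightarrow> (real \<Rightarrow> 'a \<Rightarrow> 'a) \<Rightarrow> real" where
  "semigroup_bound T X S = (SUP r\<in>{0..T}. op_norm X (S r))"

section \<open>Increments\<close>

text \<open>
  A function of \<open>n\<close> time variables takes a list \<open>[t\<^sub>1, \<dots>, t\<^sub>n]\<close> as argument. A function on the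
  simplex is represented by its extension by 0, so that equality of maps on the simplex is
  equality in HOL. A path is a function of one time variable.
\<close>

definition time_simplex :: "nat \<Rightarrow> real \<Rightarrow> real list set" where
  "time_simplex n \<tau> = {ts. length ts = n \<and> set ts \<subseteq> {0..\<tau>} \<and> sorted_wrt (\<ge>) ts}"

definition on_simplex :: "nat \<Rightarrow> real \<Rightarrow> (real list \<Rightarrow> 'a) \<Rightarrow> real list \<Rightarrow> 'a::zero" where
  "on_simplex n \<tau> g = (\<lambda>ts. if ts \<in> time_simplex n \<tau> then g ts else 0)"

definition cont_maps :: "'a::real_vector nspace \<Rightarrow> nat \<Rightarrow> real \<Rightarrow> (real list \<Rightarrow> 'a) set" where
  "cont_maps X n \<tau> = {g.
     (\<forall>ts. ts \<notin> time_simplex n \<tau> \<longrightarrow> g ts = 0) \<and>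
     (\<forall>ts\<in>time_simplex n \<tau>. g ts \<in> vecs X) \<and>
     (\<forall>ts\<in>time_simplex n \<tau>. \<forall>e>0. \<exists>d>0. \<forall>ss\<in>time_simplex n \<tau>.
        (\<forall>i<n. \<bar>ss ! i - ts ! i\<bar> < d) \<longrightarrow> nrm X (g ss - g ts) < e)}"

text \<open>List positions start at 0, hence the exponent \<open>Suc i\<close>.\<close>

definition delta :: "nat \<Rightarrow> real \<Rightarrow> (real list \<Rightarrow> 'a) \<Rightarrow> real list \<Rightarrow> 'a::real_vector" where
  "delta n \<tau> g = on_simplex (Suc n) \<tau>
     (\<lambda>ts. \<Sum>i<Suc n. (- 1) ^ Suc i *\<^sub>R g (take i ts @ drop (Suc i) ts))"

definition hat_delta ::
    "(real \<Rightarrow> 'a \<Rightarrow> 'a) \<Rightarrow> nat \<Rightarrow> real \<Rightarrow> (real list \<Rightarrow> 'a) \<Rightarrow> real list \<Rightarrow> 'a::real_vector" where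
  "hat_delta S n \<tau> g = on_simplex (Suc n) \<tau>
     (\<lambda>ts. delta n \<tau> g ts - (S (ts ! 0 - ts ! 1) (g (tl ts)) - g (tl ts)))"

definition hnorm2 :: "'a::real_vector nspace \<Rightarrow> real \<Rightarrow> real \<Rightarrow> (real list \<Rightarrow> 'a) \<Rightarrow> ennreal" where
  "hnorm2 X \<mu> \<tau> g =
     (SUP (t, s)\<in>{(t, s). 0 \<le> s \<and> s < t \<and> t \<le> \<tau>}. ennreal (nrm X (g [t, s]) / \<bar>t - s\<bar> powr \<mu>))"

definition hnorm3_split ::
    "'a::real_vector nspace \<Rightarrow> real \<Rightarrow> real \<Rightarrow> real \<Rightarrow> (real list \<Rightarrow> 'a) \<Rightarrow> ennreal" where
  "hnorm3_split X \<rho> \<mu> \<tau> h =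
     (SUP (t, u, s)\<in>{(t, u, s). 0 \<le> s \<and> s < u \<and> u < t \<and> t \<le> \<tau>}.
        ennreal (nrm X (h [t, u, s]) / (\<bar>t - u\<bar> powr \<rho> * \<bar>u - s\<bar> powr (\<mu> - \<rho>))))"

definition hnorm3 :: "'a::real_vector nspace \<Rightarrow> real \<Rightarrow> real \<Rightarrow> (real list \<Rightarrow> 'a) \<Rightarrow> ennreal" where
  "hnorm3 X \<mu> \<tau> h =
     Inf {\<Sum>j=1..m. hnorm3_split X (\<rho> j) \<mu> \<tau> (H j) | (m::nat) (\<rho> :: nat \<Rightarrow> real) H.
        (\<forall>j\<in>{1..m}. 0 < \<rho> j \<and> \<rho> j < \<mu> \<and> H j \<in> cont_maps X 3 \<tau>) \<and>
        h = (\<lambda>ts. \<Sum>j=1..m. H j ts)}"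

definition hoelder2 :: "'a::real_vector nspace \<Rightarrow> real \<Rightarrow> real \<Rightarrow> (real list \<Rightarrow> 'a) set" where
  "hoelder2 X \<mu> \<tau> = {g \<in> cont_maps X 2 \<tau>. hnorm2 X \<mu> \<tau> g < \<infinity>}"

definition hoelder3 :: "'a::real_vector nspace \<Rightarrow> real \<Rightarrow> real \<Rightarrow> (real list \<Rightarrow> 'a) set" where
  "hoelder3 X \<mu> \<tau> = {h \<in> cont_maps X 3 \<tau>. hnorm3 X \<mu> \<tau> h < \<infinity>}"

definition ZC2 :: "'a::real_vector nspace \<Rightarrow> real \<Rightarrow> (real list \<Rightarrow> 'a) set" where
  "ZC2 X \<tau> = {g \<in> cont_maps X 2 \<tau>. delta 2 \<tau> g = (\<lambda>_. 0)}"

definition hatZC3 ::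
    "'a::real_vector nspace \<Rightarrow> (real \<Rightarrow> 'a \<Rightarrow> 'a) \<Rightarrow> real \<Rightarrow> real \<Rightarrow> (real list \<Rightarrow> 'a) set" where
  "hatZC3 X S \<mu> T = {h \<in> hoelder3 X \<mu> T. hat_delta S 3 T h = (\<lambda>_. 0)}"

section \<open>Dyadic frozen increments\<close>

definition sewable :: "'a::real_vector nspace \<Rightarrow> real \<Rightarrow> real \<Rightarrow> (real list \<Rightarrow> 'a) set" where
  "sewable X \<gamma> \<tau> = {A \<in> cont_maps X 2 \<tau>. delta 2 \<tau> A \<in> hoelder3 X \<gamma> \<tau>}"

definition sewing_remainder ::
    "(real \<Rightarrow> (real list \<Rightarrow> 'a) \<Rightarrow> real list \<Rightarrow> 'a) \<Rightarrow> real \<Rightarrow> (real list \<Rightarrow> 'a)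
       \<Rightarrow> real list \<Rightarrow> 'a::real_vector" where
  "sewing_remainder J \<tau> A = (\<lambda>ts. A ts - delta 1 \<tau> (J \<tau> A) ts)"

text \<open>\<open>J \<tau>\<close> is the normalized dyadic sewing map on \<open>[0,\<tau>]\<close> and \<open>K\<close> its uniform constant.\<close>

locale low_regularity_sewing =
  fixes T :: real
    and X :: "'a::real_vector nspace"
    and \<gamma> K :: real
    and J :: "real \<Rightarrow> (real list \<Rightarrow> 'a) \<Rightarrow> real list \<Rightarrow> 'a"
  assumes path: "\<And>\<tau> A. \<tau> \<in> {0..T} \<Longrightarrow> A \<in> sewable X \<gamma> \<tau> \<Longrightarrow> J \<tau> A \<in> cont_maps X 1 \<tau>"
    and add: "\<And>\<tau> A A'. \<tau> \<in> {0..T} \<Longrightarrow> A \<in> sewable X \<gamma> \<tau> \<Longrightarrow> A' \<in> sewable X \<gamma> \<tau> \<Longrightarrow>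
          J \<tau> (\<lambda>ts. A ts + A' ts) = (\<lambda>ts. J \<tau> A ts + J \<tau> A' ts)"
    and scale: "\<And>\<tau> A c. \<tau> \<in> {0..T} \<Longrightarrow> A \<in> sewable X \<gamma> \<tau> \<Longrightarrow>
          J \<tau> (\<lambda>ts. c *\<^sub>R A ts) = (\<lambda>ts. c *\<^sub>R J \<tau> A ts)"
    and initial: "\<And>\<tau> A. \<tau> \<in> {0..T} \<Longrightarrow> A \<in> sewable X \<gamma> \<tau> \<Longrightarrow> J \<tau> A [0] = 0"
    and remainder_delta: "\<And>\<tau> A. \<tau> \<in> {0..T} \<Longrightarrow> A \<in> sewable X \<gamma> \<tau> \<Longrightarrow>
          delta 2 \<tau> (sewing_remainder J \<tau> A) = delta 2 \<tau> A"
    and remainder_hoelder: "\<And>\<tau> A. \<tau> \<in> {0..T} \<Longrightarrow> A \<in> sewable X \<gamma> \<tau> \<Longrightarrow>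
          sewing_remainder J \<tau> A \<in> hoelder2 X \<gamma> \<tau>"
    and remainder_bound: "\<And>\<tau> A. \<tau> \<in> {0..T} \<Longrightarrow> A \<in> sewable X \<gamma> \<tau> \<Longrightarrow>
          hnorm2 X \<gamma> \<tau> (sewing_remainder J \<tau> A) \<le> ennreal K * hnorm3 X \<gamma> \<tau> (delta 2 \<tau> A)"

text \<open>For \<open>k\<close> on the 3-simplex, \<open>\<Lambda>k\<close> is the remainder of \<open>(t, s) \<mapsto> - k(t, s, 0)\<close>.\<close>

definition dyadic_Lambda ::
    "(real \<Rightarrow> (real list \<Rightarrow> 'a) \<Rightarrow> real list \<Rightarrow> 'a) \<Rightarrow> real \<Rightarrow> (real list \<Rightarrow> 'a)
       \<Rightarrow> real list \<Rightarrow> 'a::real_vector" where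
  "dyadic_Lambda J \<tau> k = sewing_remainder J \<tau> (on_simplex 2 \<tau> (\<lambda>ts. - k (ts @ [0])))"

definition frozen ::
    "(real \<Rightarrow> 'a \<Rightarrow> 'a) \<Rightarrow> real \<Rightarrow> (real list \<Rightarrow> 'a) \<Rightarrow> real list \<Rightarrow> 'a::real_vector" where
  "frozen S \<tau> h = on_simplex 3 \<tau> (\<lambda>ts. S (\<tau> - hd ts) (h ts))"

definition frozen_remainder ::
    "(real \<Rightarrow> 'a \<Rightarrow> 'a) \<Rightarrow> (real \<Rightarrow> (real list \<Rightarrow> 'a) \<Rightarrow> real list \<Rightarrow> 'a) \<Rightarrow> real
       \<Rightarrow> (real list \<Rightarrow> 'a) \<Rightarrow> real list \<Rightarrow> 'a::real_vector" where
  "frozen_remainder S J \<tau> h = dyadic_Lambda J \<tau> (frozen S \<tau> h)"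

section \<open>Quotients\<close>

definition zc_rel :: "'a::real_vector nspace \<Rightarrow> real \<Rightarrow> ((real list \<Rightarrow> 'a) \<times> (real list \<Rightarrow> 'a)) set" where
  "zc_rel X \<tau> = {(r, r'). r \<in> cont_maps X 2 \<tau> \<and> r' \<in> cont_maps X 2 \<tau> \<and>
     (\<lambda>ts. r' ts - r ts) \<in> ZC2 X \<tau>}"

definition zc_class :: "'a::real_vector nspace \<Rightarrow> real \<Rightarrow> (real list \<Rightarrow> 'a) \<Rightarrow> (real list \<Rightarrow> 'a) set" where
  "zc_class X \<tau> r = zc_rel X \<tau> `` {r}"

definition qspace :: "'a::real_vector nspace \<Rightarrow> real \<Rightarrow> real \<Rightarrow> (real list \<Rightarrow> 'a) set set" where
  "qspace X \<gamma> \<tau> = {R \<in> cont_maps X 2 \<tau> // zc_rel X \<tau>. R \<inter> hoelder2 X \<gamma> \<tau> \<noteq> {}}"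

definition qseminorm :: "'a::real_vector nspace \<Rightarrow> real \<Rightarrow> real \<Rightarrow> (real list \<Rightarrow> 'a) set \<Rightarrow> ennreal" where
  "qseminorm X \<gamma> \<tau> R = (INF r\<in>R \<inter> hoelder2 X \<gamma> \<tau>. hnorm2 X \<gamma> \<tau> r)"

text \<open>
  Operations on classes are unions over all representatives; they agree with the operation on
  any single representative when the latter respects \<open>zc_rel\<close>.
\<close>

definition q_add :: "'a::real_vector nspace \<Rightarrow> real \<Rightarrow> (real list \<Rightarrow> 'a) set \<Rightarrow> (real list \<Rightarrow> 'a) set
    \<Rightarrow> (real list \<Rightarrow> 'a) set" where
  "q_add X \<tau> R Q = (\<Union>r\<in>R. \<Union>q\<in>Q. zc_class X \<tau> (\<lambda>ts. r ts + q ts))"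

definition q_scale :: "'a::real_vector nspace \<Rightarrow> real \<Rightarrow> real \<Rightarrow> (real list \<Rightarrow> 'a) set
    \<Rightarrow> (real list \<Rightarrow> 'a) set" where
  "q_scale X \<tau> c R = (\<Union>r\<in>R. zc_class X \<tau> (\<lambda>ts. c *\<^sub>R r ts))"

definition q_res :: "'a::real_vector nspace \<Rightarrow> real \<Rightarrow> (real list \<Rightarrow> 'a) set
    \<Rightarrow> (real list \<Rightarrow> 'a) set" where
  "q_res X \<tau>' R = (\<Union>r\<in>R. zc_class X \<tau>' (on_simplex 2 \<tau>' r))"

definition q_transport :: "'a::real_vector nspace \<Rightarrow> (real \<Rightarrow> 'a \<Rightarrow> 'a) \<Rightarrow> real \<Rightarrow> real
    \<Rightarrow> (real list \<Rightarrow> 'a) set \<Rightarrow> (real list \<Rightarrow> 'a) set" where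
  "q_transport X S \<tau> \<tau>' Q = (\<Union>q\<in>Q. zc_class X \<tau>' (on_simplex 2 \<tau>' (\<lambda>ts. S (\<tau> - \<tau>') (q ts))))"

type_synonym 'a qfamily = "real \<Rightarrow> (real list \<Rightarrow> 'a) set"

definition fr_norm :: "real \<Rightarrow> 'a::real_vector nspace \<Rightarrow> real \<Rightarrow> 'a qfamily \<Rightarrow> ennreal" where
  "fr_norm T X \<gamma> R = (SUP \<tau>\<in>{0..T}. qseminorm X \<gamma> \<tau> (R \<tau>))"

definition fr_space :: "real \<Rightarrow> 'a::real_vector nspace \<Rightarrow> (real \<Rightarrow> 'a \<Rightarrow> 'a) \<Rightarrow> real
    \<Rightarrow> 'a qfamily set" where
  "fr_space T X S \<gamma> = {R \<in> PiE {0..T} (qspace X \<gamma>).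
     (\<forall>\<tau> \<tau>'. 0 \<le> \<tau>' \<and> \<tau>' \<le> \<tau> \<and> \<tau> \<le> T \<longrightarrow> q_res X \<tau>' (R \<tau>) = q_transport X S \<tau> \<tau>' (R \<tau>')) \<and>
     fr_norm T X \<gamma> R < \<infinity>}"

definition fr_add :: "real \<Rightarrow> 'a::real_vector nspace \<Rightarrow> 'a qfamily \<Rightarrow> 'a qfamily \<Rightarrow> 'a qfamily" where
  "fr_add T X R Q = (\<lambda>\<tau>\<in>{0..T}. q_add X \<tau> (R \<tau>) (Q \<tau>))"

definition fr_scale :: "real \<Rightarrow> 'a::real_vector nspace \<Rightarrow> real \<Rightarrow> 'a qfamily \<Rightarrow> 'a qfamily" where
  "fr_scale T X c R = (\<lambda>\<tau>\<in>{0..T}. q_scale X \<tau> c (R \<tau>))"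

definition hat_Lambda_q :: "real \<Rightarrow> 'a::real_vector nspace \<Rightarrow> (real \<Rightarrow> 'a \<Rightarrow> 'a)
    \<Rightarrow> (real \<Rightarrow> (real list \<Rightarrow> 'a) \<Rightarrow> real list \<Rightarrow> 'a) \<Rightarrow> (real list \<Rightarrow> 'a) \<Rightarrow> 'a qfamily" where
  "hat_Lambda_q T X S J h = (\<lambda>\<tau>\<in>{0..T}. zc_class X \<tau> (frozen_remainder S J \<tau> h))"

end

theory Submission
  imports Defs
begin

text \<open>
  Let \<open>h\<close> be closed for the twisted differential, that is,
  \<open>(\<delta>h)(t, u, v, s) = S (t - u) h(u, v, s) - h(u, v, s)\<close>. Applying \<open>S (\<tau> - t)\<close> to this identity
  and using \<open>S (\<tau> - t) S (t - u) = S (\<tau> - u)\<close> shows that the frozen increment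
  \<open>h\<^sup>\<tau>(t, u, s) = S (\<tau> - t) h(t, u, s)\<close> is closed in the ordinary sense (\<open>frozen_closed\<close>). It
  therefore has the explicit primitive \<open>b(t, s) = - h\<^sup>\<tau>(t, s, 0)\<close>
  (\<open>delta_closed_primitive\<close>), and the sewing map replaces \<open>b\<close> by a primitive \<open>r\<close> of Hoelder
  regularity whose norm is at most \<open>K\<close> times that of \<open>h\<^sup>\<tau>\<close>. Freezing the terms of a splitting
  of \<open>h\<close> one by one costs a factor \<open>M\<close>, the bound of the semigroup on \<open>[0, T]\<close>
  (\<open>hnorm3_frozen\<close>); together these give the constant \<open>K M\<close> (\<open>Lambda_bound\<close>).

  The low regularity \<open>\<gamma> < 1\<close> makes \<open>r\<close> non-unique, but only up to closed increments, and two
  continuous increments differ by a closed one exactly when they have the same \<open>\<delta>\<close>. So the class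
  of \<open>r\<close> is the set of all continuous primitives of \<open>h\<^sup>\<tau>\<close> (\<open>zc_class_eq_primitives\<close>,
  \<open>Lambda_eq_primitives\<close>), and an identity between classes only has to be verified after applying
  \<open>\<delta>\<close>. Every representative has differential \<open>h\<^sup>\<tau>\<close>, and at \<open>\<tau> = t\<close> the factor
  \<open>S (\<tau> - t)\<close> is the identity. The compatibility of the classes for \<open>\<tau>' \<le> \<tau>\<close> reduces to
  \<open>S (\<tau> - \<tau>') h\<^sup>\<tau>\<^sup>' = h\<^sup>\<tau>\<close> on the smaller simplex, which is the semigroup law
  again (\<open>q_res_frozen\<close>, \<open>q_transport_frozen\<close>). Linearity is inherited from freezing and from
  the sewing map, and continuity follows from linearity and the bound.
\<close>

section \<open>Increments on the simplices\<close>

lemma time_simplex_2_iff: "[t, s] \<in> time_simplex 2 \<tau> \<longleftrightarrow> 0 \<le> s \<and> s \<le> t \<and> t \<le> \<tau>"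
  by (auto simp: time_simplex_def)

lemma time_simplex_3_iff:
  "[t, u, s] \<in> time_simplex 3 \<tau> \<longleftrightarrow> 0 \<le> s \<and> s \<le> u \<and> u \<le> t \<and> t \<le> \<tau>"
  by (auto simp: time_simplex_def)

lemma time_simplex_4_iff:
  "[t, u, v, s] \<in> time_simplex 4 \<tau> \<longleftrightarrow> 0 \<le> s \<and> s \<le> v \<and> v \<le> u \<and> u \<le> t \<and> t \<le> \<tau>"
  by (auto simp: time_simplex_def)

lemma time_simplex_3E:
  assumes "ts \<in> time_simplex 3 \<tau>"
  obtains t u s where "ts = [t, u, s]" "0 \<le> s" "s \<le> u" "u \<le> t" "t \<le> \<tau>"
  using assms by (auto simp: time_simplex_def numeral_eq_Suc length_Suc_conv)

lemma time_simplex_mono: "\<tau>' \<le> \<tau> \<Longrightarrow> time_simplex n \<tau>' \<subseteq> time_simplex n \<tau>"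
  by (auto simp: time_simplex_def)

lemma time_simplex_first:
  assumes "ts \<in> time_simplex n \<tau>" "0 < n"
  shows "0 \<le> ts ! 0" "ts ! 0 \<le> \<tau>"
proof -
  have "ts ! 0 \<in> set ts"
    using assms by (auto simp: time_simplex_def)
  then have "ts ! 0 \<in> {0..\<tau>}"
    using assms unfolding time_simplex_def by blast
  then show "0 \<le> ts ! 0" "ts ! 0 \<le> \<tau>"
    by auto
qed

lemma on_simplex_in [simp]: "ts \<in> time_simplex n \<tau> \<Longrightarrow> on_simplex n \<tau> g ts = g ts"
  by (simp add: on_simplex_def)

lemma on_simplex_out [simp]: "ts \<notin> time_simplex n \<tau> \<Longrightarrow> on_simplex n \<tau> g ts = 0"
  by (simp add: on_simplex_def)

lemma delta_add:
  "delta n \<tau> (\<lambda>ts. g ts + g' ts) = (\<lambda>ts. delta n \<tau> g ts + delta n \<tau> g' ts)"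
  unfolding delta_def on_simplex_def fun_eq_iff scaleR_add_right sum.distrib by simp

lemma delta_scale: "delta n \<tau> (\<lambda>ts. c *\<^sub>R g ts) = (\<lambda>ts. c *\<^sub>R delta n \<tau> g ts)"
proof -
  have "(\<Sum>i<Suc n. (- 1) ^ Suc i *\<^sub>R (c *\<^sub>R g (take i ts @ drop (Suc i) ts)))
      = c *\<^sub>R (\<Sum>i<Suc n. (- 1) ^ Suc i *\<^sub>R g (take i ts @ drop (Suc i) ts))" for ts
    by (simp add: scaleR_sum_right mult.commute del: sum.lessThan_Suc)
  then show ?thesis
    by (simp add: delta_def on_simplex_def fun_eq_iff del: sum.lessThan_Suc)
qed

lemma delta_diff:
  "delta n \<tau> (\<lambda>ts. g ts - g' ts) = (\<lambda>ts. delta n \<tau> g ts - delta n \<tau> g' ts)"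
  using delta_add[of n \<tau> g "\<lambda>ts. (-1) *\<^sub>R g' ts"] delta_scale[of n \<tau> "-1" g'] by simp

lemma delta_2:
  assumes "0 \<le> s" "s \<le> u" "u \<le> t" "t \<le> \<tau>"
  shows "delta 2 \<tau> g [t, u, s] = g [t, s] - g [t, u] - g [u, s]"
  using assms time_simplex_3_iff[of t u s \<tau>]
  by (simp add: delta_def on_simplex_def numeral_eq_Suc)

lemma delta_3:
  assumes "0 \<le> s" "s \<le> v" "v \<le> u" "u \<le> t" "t \<le> \<tau>"
  shows "delta 3 \<tau> h [t, u, v, s] = h [t, v, s] - h [u, v, s] - h [t, u, s] + h [t, u, v]"
  using assms time_simplex_4_iff[of t u v s \<tau>]
  by (simp add: delta_def on_simplex_def numeral_eq_Suc)

lemma delta_2_eqI: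
  assumes "\<And>ts. ts \<notin> time_simplex 3 \<tau> \<Longrightarrow> k ts = 0"
    and "\<And>t u s. 0 \<le> s \<Longrightarrow> s \<le> u \<Longrightarrow> u \<le> t \<Longrightarrow> t \<le> \<tau> \<Longrightarrow>
      g [t, s] - g [t, u] - g [u, s] = k [t, u, s]"
  shows "delta 2 \<tau> g = k"
proof
  fix ts
  show "delta 2 \<tau> g ts = k ts"
  proof (cases "ts \<in> time_simplex 3 \<tau>")
    case True
    then show ?thesis
      by (elim time_simplex_3E) (simp add: delta_2 assms(2))
  next
    case False
    then show ?thesis
      using assms(1) by (simp add: delta_def numeral_3_eq_3 numeral_2_eq_2)
  qed
qed

text \<open>
  A closed increment \<open>k\<close> of three variables has the explicit primitive \<open>(t, s) \<mapsto> - k(t, s, 0)\<close>: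
  closedness at \<open>(t, u, s, 0)\<close> is exactly the identity that is needed.
\<close>

lemma delta_closed_primitive:
  assumes "\<And>ts. ts \<notin> time_simplex 3 \<tau> \<Longrightarrow> k ts = 0" and "delta 3 \<tau> k = (\<lambda>_. 0)"
  shows "delta 2 \<tau> (on_simplex 2 \<tau> (\<lambda>ts. - k (ts @ [0]))) = k"
proof (rule delta_2_eqI)
  fix t u s :: real
  assume ord: "0 \<le> s" "s \<le> u" "u \<le> t" "t \<le> \<tau>"
  have "k [t, s, 0] - k [u, s, 0] - k [t, u, 0] + k [t, u, s] = 0"
    using delta_3[of 0 s u t \<tau> k] ord assms(2) by simp
  then show "on_simplex 2 \<tau> (\<lambda>ts. - k (ts @ [0])) [t, s]
      - on_simplex 2 \<tau> (\<lambda>ts. - k (ts @ [0])) [t, u]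
      - on_simplex 2 \<tau> (\<lambda>ts. - k (ts @ [0])) [u, s] = k [t, u, s]"
    using ord by (simp add: time_simplex_2_iff algebra_simps)
qed (use assms in auto)

section \<open>Continuous increments form a vector space\<close>

lemma
  assumes "banach_space X"
  shows banach_zero: "0 \<in> vecs X"
    and banach_add: "x \<in> vecs X \<Longrightarrow> y \<in> vecs X \<Longrightarrow> x + y \<in> vecs X"
    and banach_diff: "x \<in> vecs X \<Longrightarrow> y \<in> vecs X \<Longrightarrow> x - y \<in> vecs X"
    and banach_scale: "x \<in> vecs X \<Longrightarrow> c *\<^sub>R x \<in> vecs X"
  using assms subspace_diff[of "vecs X" x y]
  by (auto simp: banach_space_def subspace_def)

lemma
  assumes "banach_space X"
  shows banach_norm_nonneg: "x \<in> vecs X \<Longrightarrow> 0 \<le> nrm X x"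
    and banach_norm_zero: "nrm X 0 = 0"
    and banach_norm_eq_0: "x \<in> vecs X \<Longrightarrow> nrm X x = 0 \<Longrightarrow> x = 0"
    and banach_norm_scale: "x \<in> vecs X \<Longrightarrow> nrm X (c *\<^sub>R x) = \<bar>c\<bar> * nrm X x"
    and banach_norm_triangle: "x \<in> vecs X \<Longrightarrow> y \<in> vecs X \<Longrightarrow> nrm X (x + y) \<le> nrm X x + nrm X y"
  using assms banach_zero[OF assms] unfolding banach_space_def by blast+

lemma cont_maps_vecs:
  assumes "banach_space X" "g \<in> cont_maps X n \<tau>"
  shows "g ts \<in> vecs X"
  using assms banach_zero[OF assms(1)] by (cases "ts \<in> time_simplex n \<tau>") (auto simp: cont_maps_def)

lemma cont_maps_add:
  assumes X: "banach_space X" and g: "g \<in> cont_maps X n \<tau>" and g': "g' \<in> cont_maps X n \<tau>"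
  shows "(\<lambda>ts. g ts + g' ts) \<in> cont_maps X n \<tau>"
proof -
  have "\<exists>d>0. \<forall>ss\<in>time_simplex n \<tau>. (\<forall>i<n. \<bar>ss ! i - ts ! i\<bar> < d) \<longrightarrow>
      nrm X (g ss + g' ss - (g ts + g' ts)) < e"
    if ts: "ts \<in> time_simplex n \<tau>" and e: "0 < e" for ts e
  proof -
    obtain d where d: "d > 0" "\<And>ss. ss \<in> time_simplex n \<tau> \<Longrightarrow> \<forall>i<n. \<bar>ss ! i - ts ! i\<bar> < d \<Longrightarrow>
        nrm X (g ss - g ts) < e / 2"
      using g ts half_gt_zero[OF e] unfolding cont_maps_def by blast
    obtain d' where d': "d' > 0" "\<And>ss. ss \<in> time_simplex n \<tau> \<Longrightarrow> \<forall>i<n. \<bar>ss ! i - ts ! i\<bar> < d' \<Longrightarrow>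
        nrm X (g' ss - g' ts) < e / 2"
      using g' ts half_gt_zero[OF e] unfolding cont_maps_def by blast
    have "nrm X (g ss + g' ss - (g ts + g' ts)) < e"
      if "ss \<in> time_simplex n \<tau>" "\<forall>i<n. \<bar>ss ! i - ts ! i\<bar> < min d d'" for ss
    proof -
      have "nrm X ((g ss - g ts) + (g' ss - g' ts)) \<le> nrm X (g ss - g ts) + nrm X (g' ss - g' ts)"
        using X g g' by (intro banach_norm_triangle banach_diff cont_maps_vecs)
      also have "\<dots> < e"
        using d(2)[of ss] d'(2)[of ss] that by fastforce
      finally show ?thesis
        by (simp add: algebra_simps)
    qed
    then show ?thesis
      using d(1) d'(1) by (intro exI[of _ "min d d'"]) auto
  qed
  then show ?thesis
    using g g' X cont_maps_vecs[OF X g] cont_maps_vecs[OF X g']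
    by (simp add: cont_maps_def banach_add)
qed

lemma cont_maps_scale:
  assumes X: "banach_space X" and g: "g \<in> cont_maps X n \<tau>"
  shows "(\<lambda>ts. c *\<^sub>R g ts) \<in> cont_maps X n \<tau>"
proof -
  have "\<exists>d>0. \<forall>ss\<in>time_simplex n \<tau>. (\<forall>i<n. \<bar>ss ! i - ts ! i\<bar> < d) \<longrightarrow>
      nrm X (c *\<^sub>R g ss - c *\<^sub>R g ts) < e"
    if ts: "ts \<in> time_simplex n \<tau>" and e: "0 < e" for ts e
  proof -
    have "0 < e / (\<bar>c\<bar> + 1)"
      using e by simp
    then obtain d where d: "d > 0" "\<And>ss. ss \<in> time_simplex n \<tau> \<Longrightarrow>
        \<forall>i<n. \<bar>ss ! i - ts ! i\<bar> < d \<Longrightarrow> nrm X (g ss - g ts) < e / (\<bar>c\<bar> + 1)"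
      using g ts unfolding cont_maps_def by blast
    have "nrm X (c *\<^sub>R g ss - c *\<^sub>R g ts) < e"
      if "ss \<in> time_simplex n \<tau>" "\<forall>i<n. \<bar>ss ! i - ts ! i\<bar> < d" for ss
    proof -
      have v: "g ss - g ts \<in> vecs X"
        using X g by (intro banach_diff cont_maps_vecs)
      have "nrm X (c *\<^sub>R g ss - c *\<^sub>R g ts) = \<bar>c\<bar> * nrm X (g ss - g ts)"
        using banach_norm_scale[OF X v, of c] by (simp add: scaleR_diff_right)
      also have "\<dots> \<le> (\<bar>c\<bar> + 1) * nrm X (g ss - g ts)"
        using banach_norm_nonneg[OF X v] by (simp add: mult_right_mono)
      also have "\<dots> < e"
        using d(2)[OF that] by (simp add: field_simps)
      finally show ?thesis .
    qed
    then show ?thesis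
      using d(1) by blast
  qed
  then show ?thesis
    using g X cont_maps_vecs[OF X g] by (simp add: cont_maps_def banach_scale)
qed

lemma cont_maps_diff:
  assumes "banach_space X" "g \<in> cont_maps X n \<tau>" "g' \<in> cont_maps X n \<tau>"
  shows "(\<lambda>ts. g ts - g' ts) \<in> cont_maps X n \<tau>"
  using cont_maps_add[OF assms(1,2) cont_maps_scale[OF assms(1,3), of "-1"]] by simp

lemma cont_maps_append_zero:
  assumes X: "banach_space X" and k: "k \<in> cont_maps X (Suc n) \<tau>" and "0 \<le> \<tau>"
  shows "on_simplex n \<tau> (\<lambda>ts. - k (ts @ [0])) \<in> cont_maps X n \<tau>"
proof -
  have sim: "ts @ [0] \<in> time_simplex (Suc n) \<tau>" if "ts \<in> time_simplex n \<tau>" for ts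
    using that \<open>0 \<le> \<tau>\<close> by (auto simp: time_simplex_def sorted_wrt_append)
  have "on_simplex n \<tau> (\<lambda>ts. k (ts @ [0])) \<in> cont_maps X n \<tau>"
    unfolding cont_maps_def mem_Collect_eq
  proof (intro conjI ballI allI impI)
    fix ts and e :: real assume ts: "ts \<in> time_simplex n \<tau>" and e: "0 < e"
    obtain d where d: "d > 0" "\<And>ss. ss \<in> time_simplex (Suc n) \<tau> \<Longrightarrow>
        \<forall>i<Suc n. \<bar>ss ! i - (ts @ [0]) ! i\<bar> < d \<Longrightarrow> nrm X (k ss - k (ts @ [0])) < e"
      using k sim[OF ts] e unfolding cont_maps_def by blast
    have "nrm X (k (ss @ [0]) - k (ts @ [0])) < e"
      if ss: "ss \<in> time_simplex n \<tau>" and close: "\<forall>i<n. \<bar>ss ! i - ts ! i\<bar> < d" for ss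
    proof (rule d(2)[OF sim[OF ss]])
      have "length ss = n" "length ts = n"
        using ss ts by (auto simp: time_simplex_def)
      then show "\<forall>i<Suc n. \<bar>(ss @ [0]) ! i - (ts @ [0]) ! i\<bar> < d"
        using close d(1) by (auto simp: nth_append less_Suc_eq)
    qed
    then show "\<exists>d>0. \<forall>ss\<in>time_simplex n \<tau>. (\<forall>i<n. \<bar>ss ! i - ts ! i\<bar> < d) \<longrightarrow>
        nrm X (on_simplex n \<tau> (\<lambda>ts. k (ts @ [0])) ss - on_simplex n \<tau> (\<lambda>ts. k (ts @ [0])) ts) < e"
      using d(1) ts by auto
  qed (use cont_maps_vecs[OF X k] in auto)
  from cont_maps_scale[OF X this, of "-1"]
  show ?thesis
    by (rule back_subst[where P = "\<lambda>g. g \<in> _"]) (auto simp: on_simplex_def)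
qed

section \<open>Classes modulo closed increments are sets of primitives\<close>

definition primitives ::
    "'a::real_vector nspace \<Rightarrow> real \<Rightarrow> (real list \<Rightarrow> 'a) \<Rightarrow> (real list \<Rightarrow> 'a) set" where
  "primitives X \<tau> k = {r \<in> cont_maps X 2 \<tau>. delta 2 \<tau> r = k}"

text \<open>
  Two continuous increments differ by a closed one if and only if they have the same \<open>\<delta>\<close>. A class
  is thus known as soon as the \<open>\<delta>\<close> of one of its members is, and identities between classes
  become identities between increments of three variables.
\<close>

lemma zc_class_eq_primitives:
  assumes X: "banach_space X" and r: "r \<in> cont_maps X 2 \<tau>"
  shows "zc_class X \<tau> r = primitives X \<tau> (delta 2 \<tau> r)"
  using r cont_maps_diff[OF X _ r]
  by (auto simp: zc_class_def zc_rel_def ZC2_def primitives_def delta_diff fun_eq_iff)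

lemma zc_class_primitive:
  assumes "banach_space X" "r \<in> primitives X \<tau> k"
  shows "zc_class X \<tau> r = primitives X \<tau> k"
  using assms zc_class_eq_primitives by (auto simp: primitives_def)

lemma primitives_in_quotient:
  assumes "banach_space X" "r \<in> primitives X \<tau> k"
  shows "primitives X \<tau> k \<in> cont_maps X 2 \<tau> // zc_rel X \<tau>"
  using assms zc_class_primitive[OF assms]
  by (auto simp: quotient_def zc_class_def primitives_def)

lemma q_add_primitives:
  assumes X: "banach_space X" and "r \<in> primitives X \<tau> k" "r' \<in> primitives X \<tau> k'"
  shows "q_add X \<tau> (primitives X \<tau> k) (primitives X \<tau> k') = primitives X \<tau> (\<lambda>ts. k ts + k' ts)"
proof -
  have "zc_class X \<tau> (\<lambda>ts. p ts + p' ts) = primitives X \<tau> (\<lambda>ts. k ts + k' ts)"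
    if "p \<in> primitives X \<tau> k" "p' \<in> primitives X \<tau> k'" for p p'
    by (rule zc_class_primitive[OF X])
      (use that in \<open>auto simp: primitives_def delta_add intro: cont_maps_add[OF X]\<close>)
  then show ?thesis
    using assms(2,3) unfolding q_add_def by blast
qed

lemma q_scale_primitives:
  assumes X: "banach_space X" and "r \<in> primitives X \<tau> k"
  shows "q_scale X \<tau> c (primitives X \<tau> k) = primitives X \<tau> (\<lambda>ts. c *\<^sub>R k ts)"
proof -
  have "zc_class X \<tau> (\<lambda>ts. c *\<^sub>R p ts) = primitives X \<tau> (\<lambda>ts. c *\<^sub>R k ts)"
    if "p \<in> primitives X \<tau> k" for p
    by (rule zc_class_primitive[OF X])
      (use that in \<open>auto simp: primitives_def delta_scale intro: cont_maps_scale[OF X]\<close>)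
  then show ?thesis
    using assms(2) unfolding q_scale_def by blast
qed

section \<open>Strongly continuous semigroups with a uniform bound\<close>

locale bounded_semigroup =
  fixes T :: real
    and X :: "'a::real_vector nspace"
    and S :: "real \<Rightarrow> 'a \<Rightarrow> 'a"
  assumes horizon: "0 \<le> T"
    and space: "banach_space X"
    and semigroup: "c0_semigroup X S"
    and bounded: "bdd_above ((\<lambda>r. op_norm X (S r)) ` {0..T})"
begin

abbreviation M :: real where "M \<equiv> semigroup_bound T X S"

lemma S_vecs: "0 \<le> r \<Longrightarrow> x \<in> vecs X \<Longrightarrow> S r x \<in> vecs X"
  using semigroup by (auto simp: c0_semigroup_def bounded_op_def)

lemma S_add: "0 \<le> r \<Longrightarrow> x \<in> vecs X \<Longrightarrow> y \<in> vecs X \<Longrightarrow> S r (x + y) = S r x + S r y"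
  using semigroup by (auto simp: c0_semigroup_def bounded_op_def linear_on_vecs_def)

lemma S_scale: "0 \<le> r \<Longrightarrow> x \<in> vecs X \<Longrightarrow> S r (c *\<^sub>R x) = c *\<^sub>R S r x"
  using semigroup by (auto simp: c0_semigroup_def bounded_op_def linear_on_vecs_def)

lemma S_zero: "0 \<le> r \<Longrightarrow> S r 0 = 0"
  using S_scale[of r 0 0] banach_zero[OF space] by simp

lemma S_diff: "0 \<le> r \<Longrightarrow> x \<in> vecs X \<Longrightarrow> y \<in> vecs X \<Longrightarrow> S r (x - y) = S r x - S r y"
  using S_add[of r x "(-1) *\<^sub>R y"] S_scale[of r y "-1"] banach_scale[OF space, of y "-1"] by simp

lemma S_sum: "0 \<le> r \<Longrightarrow> (\<And>j. j \<in> A \<Longrightarrow> f j \<in> vecs X) \<Longrightarrow> S r (\<Sum>j\<in>A. f j) = (\<Sum>j\<in>A. S r (f j))"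
proof (induction A rule: infinite_finite_induct)
  case (insert a A)
  have "(\<Sum>j\<in>A. f j) \<in> vecs X"
    using insert.prems space by (auto simp: banach_space_def intro: subspace_sum)
  then show ?case
    using insert by (simp add: S_add)
qed (auto simp: S_zero)

lemma S_0: "x \<in> vecs X \<Longrightarrow> S 0 x = x"
  using semigroup by (simp add: c0_semigroup_def)

lemma S_compose: "0 \<le> r \<Longrightarrow> 0 \<le> r' \<Longrightarrow> x \<in> vecs X \<Longrightarrow> S r (S r' x) = S (r + r') x"
  using semigroup by (simp add: c0_semigroup_def)

lemma norm_S_le_op_norm:
  assumes "0 \<le> r" "x \<in> vecs X"
  shows "nrm X (S r x) \<le> op_norm X (S r) * nrm X x"
proof (cases "x = 0")
  case True
  then show ?thesis
    using S_zero[OF assms(1)] banach_norm_zero[OF space] by simp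
next
  case False
  then have pos: "0 < nrm X x"
    using banach_norm_nonneg[OF space assms(2)] banach_norm_eq_0[OF space assms(2)]
    by (auto simp: less_le)
  have "bounded_op X (S r)"
    using semigroup assms(1) by (simp add: c0_semigroup_def)
  then obtain L where L: "\<And>y. y \<in> vecs X \<Longrightarrow> nrm X (S r y) \<le> L * nrm X y"
    by (auto simp: bounded_op_def)
  have bdd: "bdd_above ((\<lambda>y. nrm X (S r y)) ` {y \<in> vecs X. nrm X y \<le> 1})"
  proof (rule bdd_aboveI2)
    fix y assume y: "y \<in> {y \<in> vecs X. nrm X y \<le> 1}"
    then have "nrm X (S r y) \<le> L * nrm X y"
      by (simp add: L)
    also have "\<dots> \<le> \<bar>L\<bar> * 1"
      using y banach_norm_nonneg[OF space, of y] by (intro mult_mono) auto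
    finally show "nrm X (S r y) \<le> \<bar>L\<bar>"
      by simp
  qed
  let ?y = "(1 / nrm X x) *\<^sub>R x"
  have "nrm X ?y = 1"
    using pos by (subst banach_norm_scale[OF space assms(2)]) simp
  then have "?y \<in> {y \<in> vecs X. nrm X y \<le> 1}"
    using banach_scale[OF space assms(2)] by simp
  from cSUP_upper[OF this bdd] have "nrm X (S r ?y) \<le> op_norm X (S r)"
    by (simp add: op_norm_def)
  moreover have "nrm X (S r ?y) = nrm X (S r x) / nrm X x"
    unfolding S_scale[OF assms] using pos
    by (subst banach_norm_scale[OF space S_vecs[OF assms]]) simp
  ultimately show ?thesis
    using pos by (simp add: pos_divide_le_eq)
qed

lemma norm_S_le:
  assumes "0 \<le> r" "r \<le> T" "x \<in> vecs X"
  shows "nrm X (S r x) \<le> M * nrm X x"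
proof -
  have "op_norm X (S r) \<le> M"
    unfolding semigroup_bound_def using assms by (intro cSUP_upper bounded) auto
  then have "op_norm X (S r) * nrm X x \<le> M * nrm X x"
    using banach_norm_nonneg[OF space assms(3)] by (rule mult_right_mono)
  with norm_S_le_op_norm[OF assms(1,3)] show ?thesis
    by (rule order_trans)
qed

text \<open>
  The zero space has \<open>M = 0\<close>; on any other space, \<open>S\<^sub>0 = Id\<close> gives \<open>M \<ge> 1\<close>.
\<close>

lemma M_nonneg: "0 \<le> M"
proof (cases "\<exists>x\<in>vecs X. x \<noteq> 0")
  case True
  then obtain x where x: "x \<in> vecs X" "x \<noteq> 0"
    by blast
  have "nrm X x \<noteq> 0"
    using banach_norm_eq_0[OF space x(1)] x(2) by blast
  then have "0 < nrm X x"
    using banach_norm_nonneg[OF space x(1)] by linarith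
  moreover have "nrm X x \<le> M * nrm X x"
    using norm_S_le[OF order_refl horizon x(1)] unfolding S_0[OF x(1)] .
  ultimately have "1 \<le> M"
    by simp
  then show ?thesis
    by linarith
next
  case False
  then have "{x \<in> vecs X. nrm X x \<le> 1} = {0}"
    using banach_zero[OF space] banach_norm_zero[OF space] by force
  then have "op_norm X (S r) = 0" if "r \<in> {0..T}" for r
    unfolding op_norm_def using that by (simp add: S_zero banach_norm_zero[OF space])
  then have "(\<lambda>r. op_norm X (S r)) ` {0..T} = {0}"
    using horizon by (intro equalityI image_subsetI) force+
  then show ?thesis
    unfolding semigroup_bound_def by simp
qed

text \<open>
  Joint continuity of \<open>(p, x) \<mapsto> S p x\<close>, from strong continuity and the uniform bound:
  \<open>S p y - S q x = S p (y - x) + (S p x - S q x)\<close>. The time \<open>c ts\<close> is \<open>\<tau> - t\<close>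
  when increments are frozen at \<open>\<tau>\<close> and is constant when they are transported or restricted.
\<close>

lemma cont_maps_semigroup:
  assumes g: "g \<in> cont_maps X n \<tau>" and \<tau>': "\<tau>' \<le> \<tau>" and n: "0 < n"
    and range: "\<And>ts. ts \<in> time_simplex n \<tau>' \<Longrightarrow> c ts \<in> {0..T}"
    and lip: "\<And>ts ss. ts \<in> time_simplex n \<tau>' \<Longrightarrow> ss \<in> time_simplex n \<tau>' \<Longrightarrow>
      \<bar>c ss - c ts\<bar> \<le> \<bar>ss ! 0 - ts ! 0\<bar>"
  shows "on_simplex n \<tau>' (\<lambda>ts. S (c ts) (g ts)) \<in> cont_maps X n \<tau>'"
  unfolding cont_maps_def mem_Collect_eq
proof (intro conjI ballI allI impI)
  note v = cont_maps_vecs[OF space g]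
  show "on_simplex n \<tau>' (\<lambda>ts. S (c ts) (g ts)) ts \<in> vecs X" if "ts \<in> time_simplex n \<tau>'" for ts
    using that range[OF that] S_vecs v by simp
  fix ts and e :: real assume ts: "ts \<in> time_simplex n \<tau>'" and e: "0 < e"
  have ts': "ts \<in> time_simplex n \<tau>"
    using ts time_simplex_mono[OF \<tau>'] by blast
  have "0 < e / (2 * (M + 1))"
    using e M_nonneg by simp
  then obtain d where d: "d > 0" "\<And>ss. ss \<in> time_simplex n \<tau> \<Longrightarrow>
      \<forall>i<n. \<bar>ss ! i - ts ! i\<bar> < d \<Longrightarrow> nrm X (g ss - g ts) < e / (2 * (M + 1))"
    using g ts' unfolding cont_maps_def by blast
  have "((\<lambda>s. nrm X (S s (g ts) - S (c ts) (g ts))) \<longlongrightarrow> 0) (at (c ts) within {0..})"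
    using semigroup v range[OF ts] unfolding c0_semigroup_def by auto
  then have "\<forall>\<^sub>F s in at (c ts) within {0..}. \<bar>nrm X (S s (g ts) - S (c ts) (g ts))\<bar> < e / 2"
    using half_gt_zero[OF e] unfolding tendsto_iff dist_real_def diff_0_right by blast
  then obtain d' where d': "d' > 0" "\<And>s. 0 \<le> s \<Longrightarrow> s \<noteq> c ts \<Longrightarrow> \<bar>s - c ts\<bar> < d' \<Longrightarrow>
      \<bar>nrm X (S s (g ts) - S (c ts) (g ts))\<bar> < e / 2"
    unfolding eventually_at dist_real_def by auto
  have "nrm X (S (c ss) (g ss) - S (c ts) (g ts)) < e"
    if ss: "ss \<in> time_simplex n \<tau>'" and close: "\<forall>i<n. \<bar>ss ! i - ts ! i\<bar> < min d d'" for ss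
  proof -
    have c: "0 \<le> c ss" "c ss \<le> T" "0 \<le> c ts"
      using range[OF ss] range[OF ts] by auto
    have "nrm X (S (c ss) (g ss - g ts)) \<le> M * nrm X (g ss - g ts)"
      using c v by (intro norm_S_le banach_diff[OF space]) auto
    also have "\<dots> \<le> (M + 1) * nrm X (g ss - g ts)"
      using banach_norm_nonneg[OF space banach_diff[OF space v v]] by (simp add: mult_right_mono)
    also have "\<dots> < e / 2"
    proof -
      have "nrm X (g ss - g ts) < e / (2 * (M + 1))"
        using close time_simplex_mono[OF \<tau>'] by (intro d(2) subsetD[OF _ ss]) auto
      then show ?thesis
        using M_nonneg by (simp add: field_simps)
    qed
    finally have space_part: "nrm X (S (c ss) (g ss - g ts)) < e / 2" .
    have "\<bar>ss ! 0 - ts ! 0\<bar> < d'"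
      using close n by simp
    then have "\<bar>c ss - c ts\<bar> < d'"
      using lip[OF ts ss] by linarith
    then have time_part: "nrm X (S (c ss) (g ts) - S (c ts) (g ts)) < e / 2"
    proof (cases "c ss = c ts")
      case True
      then show ?thesis
        using e banach_norm_zero[OF space] by simp
    next
      case False
      then show ?thesis
        using d'(2)[OF c(1) False] \<open>\<bar>c ss - c ts\<bar> < d'\<close> by linarith
    qed
    have split: "S (c ss) (g ss) - S (c ts) (g ts)
        = S (c ss) (g ss - g ts) + (S (c ss) (g ts) - S (c ts) (g ts))"
      using c v by (simp add: S_diff)
    have "nrm X (S (c ss) (g ss - g ts) + (S (c ss) (g ts) - S (c ts) (g ts)))
        \<le> nrm X (S (c ss) (g ss - g ts)) + nrm X (S (c ss) (g ts) - S (c ts) (g ts))"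
      using c v by (intro banach_norm_triangle[OF space] banach_diff[OF space] S_vecs) auto
    then show ?thesis
      unfolding split using space_part time_part by linarith
  qed
  then show "\<exists>d>0. \<forall>ss\<in>time_simplex n \<tau>'. (\<forall>i<n. \<bar>ss ! i - ts ! i\<bar> < d) \<longrightarrow>
      nrm X (on_simplex n \<tau>' (\<lambda>ts. S (c ts) (g ts)) ss - on_simplex n \<tau>' (\<lambda>ts. S (c ts) (g ts)) ts) < e"
    using d(1) d'(1) ts by (intro exI[of _ "min d d'"]) auto
qed simp

lemma cont_maps_restrict:
  assumes g: "g \<in> cont_maps X n \<tau>" and "\<tau>' \<le> \<tau>" "0 < n"
  shows "on_simplex n \<tau>' g \<in> cont_maps X n \<tau>'"
proof -
  have "on_simplex n \<tau>' (\<lambda>ts. S 0 (g ts)) \<in> cont_maps X n \<tau>'"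
    by (rule cont_maps_semigroup[OF assms]) (use horizon in auto)
  then show ?thesis
    by (simp add: S_0 cont_maps_vecs[OF space g])
qed

section \<open>Freezing an increment at its final time\<close>

lemma frozen_apply:
  assumes "0 \<le> s" "s \<le> u" "u \<le> t" "t \<le> \<tau>"
  shows "frozen S \<tau> h [t, u, s] = S (\<tau> - t) (h [t, u, s])"
  using assms by (simp add: frozen_def time_simplex_3_iff)

lemma frozen_cong:
  assumes "\<And>t u s. 0 \<le> s \<Longrightarrow> s \<le> u \<Longrightarrow> u \<le> t \<Longrightarrow> t \<le> \<tau> \<Longrightarrow>
      S (\<tau> - t) (h [t, u, s]) = k [t, u, s]"
    and "\<And>ts. ts \<notin> time_simplex 3 \<tau> \<Longrightarrow> k ts = 0"
  shows "frozen S \<tau> h = k"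
proof
  fix ts
  show "frozen S \<tau> h ts = k ts"
  proof (cases "ts \<in> time_simplex 3 \<tau>")
    case True
    then show ?thesis
      by (elim time_simplex_3E) (simp add: frozen_apply assms(1))
  qed (simp add: frozen_def assms(2))
qed

lemma frozen_add:
  assumes "h \<in> cont_maps X 3 T" "k \<in> cont_maps X 3 T"
  shows "frozen S \<tau> (\<lambda>ts. h ts + k ts) = (\<lambda>ts. frozen S \<tau> h ts + frozen S \<tau> k ts)"
  by (rule frozen_cong)
    (use cont_maps_vecs[OF space assms(1)] cont_maps_vecs[OF space assms(2)]
      in \<open>auto simp: frozen_apply S_add, auto simp: frozen_def\<close>)

lemma frozen_scale:
  assumes "h \<in> cont_maps X 3 T"
  shows "frozen S \<tau> (\<lambda>ts. c *\<^sub>R h ts) = (\<lambda>ts. c *\<^sub>R frozen S \<tau> h ts)"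
  by (rule frozen_cong)
    (use cont_maps_vecs[OF space assms] in \<open>auto simp: frozen_apply S_scale, auto simp: frozen_def\<close>)

lemma frozen_cont_maps:
  assumes "h \<in> cont_maps X 3 T" "0 \<le> \<tau>" "\<tau> \<le> T"
  shows "frozen S \<tau> h \<in> cont_maps X 3 \<tau>"
proof -
  have "frozen S \<tau> h = on_simplex 3 \<tau> (\<lambda>ts. S (\<tau> - ts ! 0) (h ts))"
    unfolding frozen_def by (rule ext) (auto simp: on_simplex_def elim!: time_simplex_3E)
  also have "\<dots> \<in> cont_maps X 3 \<tau>"
  proof (rule cont_maps_semigroup[OF assms(1,3)])
    fix ts assume "ts \<in> time_simplex 3 \<tau>"
    then show "\<tau> - ts ! 0 \<in> {0..T}"
      using time_simplex_first[of ts 3 \<tau>] assms by simp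
  qed auto
  finally show ?thesis .
qed

text \<open>
  Freezing conjugates the twisted differential into the ordinary one: by
  \<open>S (\<tau> - t) S (t - u) = S (\<tau> - u)\<close>, the term \<open>S (t - u) h(u, v, s)\<close> of the former becomes
  the term \<open>h\<^sup>\<tau>(u, v, s)\<close> of the latter.
\<close>

lemma frozen_closed:
  assumes h: "h \<in> cont_maps X 3 T" "hat_delta S 3 T h = (\<lambda>_. 0)" and \<tau>: "0 \<le> \<tau>" "\<tau> \<le> T"
  shows "delta 3 \<tau> (frozen S \<tau> h) = (\<lambda>_. 0)"
proof
  fix ts
  show "delta 3 \<tau> (frozen S \<tau> h) ts = 0"
  proof (cases "ts \<in> time_simplex 4 \<tau>")
    case True
    then obtain t u v s where ts: "ts = [t, u, v, s]"
      by (auto simp: time_simplex_def numeral_eq_Suc length_Suc_conv)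
    have ord: "0 \<le> s" "s \<le> v" "v \<le> u" "u \<le> t" "t \<le> \<tau>"
      using True time_simplex_4_iff unfolding ts by auto
    note vs = cont_maps_vecs[OF space h(1)]
    have "hat_delta S 3 T h [t, u, v, s] =
        delta 3 T h [t, u, v, s] - (S (t - u) (h [u, v, s]) - h [u, v, s])"
      using ord \<tau> time_simplex_4_iff[of t u v s T] by (simp add: hat_delta_def)
    then have "S (t - u) (h [u, v, s]) = h [t, v, s] - h [t, u, s] + h [t, u, v]"
      using h(2) delta_3[of s v u t T h] ord \<tau> by (simp add: algebra_simps)
    then have "S (\<tau> - t) (S (t - u) (h [u, v, s]))
        = S (\<tau> - t) (h [t, v, s]) - S (\<tau> - t) (h [t, u, s]) + S (\<tau> - t) (h [t, u, v])"
      using ord vs by (simp add: S_add S_diff banach_diff[OF space])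
    moreover have "S (\<tau> - t) (S (t - u) (h [u, v, s])) = S (\<tau> - u) (h [u, v, s])"
      using ord vs by (simp add: S_compose)
    ultimately show ?thesis
      using ord by (simp add: ts delta_3 frozen_apply algebra_simps)
  qed (simp add: delta_def)
qed

lemma hnorm3_split_frozen:
  assumes h: "h \<in> cont_maps X 3 T" and "\<tau> \<le> T"
  shows "hnorm3_split X \<rho> \<mu> \<tau> (frozen S \<tau> h) \<le> ennreal M * hnorm3_split X \<rho> \<mu> T h"
  unfolding hnorm3_split_def[of X \<rho> \<mu> \<tau>]
proof (rule SUP_least, clarify)
  fix t u s :: real
  assume ord: "0 \<le> s" "s < u" "u < t" "t \<le> \<tau>"
  let ?w = "\<bar>t - u\<bar> powr \<rho> * \<bar>u - s\<bar> powr (\<mu> - \<rho>)"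
  have v: "h [t, u, s] \<in> vecs X"
    by (rule cont_maps_vecs[OF space h])
  have "nrm X (frozen S \<tau> h [t, u, s]) \<le> M * nrm X (h [t, u, s])"
    using ord \<open>\<tau> \<le> T\<close> v by (simp add: frozen_apply norm_S_le)
  then have "ennreal (nrm X (frozen S \<tau> h [t, u, s]) / ?w)
      \<le> ennreal (M * (nrm X (h [t, u, s]) / ?w))"
    by (simp add: divide_right_mono ennreal_leI)
  also have "\<dots> = ennreal M * ennreal (nrm X (h [t, u, s]) / ?w)"
    using M_nonneg banach_norm_nonneg[OF space v] by (intro ennreal_mult) auto
  also have "\<dots> \<le> ennreal M * hnorm3_split X \<rho> \<mu> T h"
    unfolding hnorm3_split_def
    by (rule mult_left_mono, rule SUP_upper2[of "(t, u, s)"]) (use ord \<open>\<tau> \<le> T\<close> in auto)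
  finally show "ennreal (nrm X (frozen S \<tau> h [t, u, s]) / ?w) \<le> ennreal M * hnorm3_split X \<rho> \<mu> T h" .
qed

text \<open>
  Freezing a splitting \<open>h = \<Sum> h\<^sub>j\<close> term by term gives a splitting of the frozen increment, so
  the infimum over splittings grows at most by the factor \<open>M\<close>.
\<close>

lemma hnorm3_frozen:
  assumes "h \<in> hoelder3 X \<mu> T" and \<tau>: "0 \<le> \<tau>" "\<tau> \<le> T"
  shows "hnorm3 X \<mu> \<tau> (frozen S \<tau> h) \<le> ennreal M * hnorm3 X \<mu> T h"
proof -
  have h: "hnorm3 X \<mu> T h < \<infinity>"
    using assms by (simp add: hoelder3_def)
  have splitting: "hnorm3 X \<mu> \<tau> (frozen S \<tau> h) \<le> ennreal M * (\<Sum>j=1..m. hnorm3_split X (\<rho> j) \<mu> T (H j))"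
    if adm: "\<forall>j\<in>{1..m}. 0 < \<rho> j \<and> \<rho> j < \<mu> \<and> H j \<in> cont_maps X 3 T"
      and hH: "h = (\<lambda>ts. \<Sum>j=1..m. H j ts)" for m :: nat and \<rho> :: "nat \<Rightarrow> real" and H
  proof -
    have "frozen S \<tau> h = (\<lambda>ts. \<Sum>j=1..m. frozen S \<tau> (H j) ts)"
    proof (rule frozen_cong)
      fix t u s :: real
      assume ord: "0 \<le> s" "s \<le> u" "u \<le> t" "t \<le> \<tau>"
      have "S (\<tau> - t) (\<Sum>j=1..m. H j [t, u, s]) = (\<Sum>j=1..m. S (\<tau> - t) (H j [t, u, s]))"
        using ord adm by (intro S_sum) (auto intro: cont_maps_vecs[OF space])
      then show "S (\<tau> - t) (h [t, u, s]) = (\<Sum>j=1..m. frozen S \<tau> (H j) [t, u, s])"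
        using ord by (simp add: hH frozen_apply)
    qed (simp add: frozen_def)
    then have "hnorm3 X \<mu> \<tau> (frozen S \<tau> h) \<le> (\<Sum>j=1..m. hnorm3_split X (\<rho> j) \<mu> \<tau> (frozen S \<tau> (H j)))"
      unfolding hnorm3_def using adm \<tau>
      by (intro Inf_lower CollectI exI[of _ m] exI[of _ \<rho>] exI[of _ "\<lambda>j. frozen S \<tau> (H j)"])
        (auto intro: frozen_cont_maps)
    also have "\<dots> \<le> (\<Sum>j=1..m. ennreal M * hnorm3_split X (\<rho> j) \<mu> T (H j))"
      using adm \<tau> by (intro sum_mono hnorm3_split_frozen) auto
    finally show ?thesis
      by (simp add: sum_distrib_left)
  qed
  show ?thesis
  proof (cases "M = 0")
    case True
    \<comment> \<open>Here \<open>0\<close> times the infimum is \<open>0\<close>; one splitting is enough, and a finite norm provides it.\<close>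
    obtain m :: nat and \<rho> H where "\<forall>j\<in>{1..m}. 0 < \<rho> j \<and> \<rho> j < \<mu> \<and> H j \<in> cont_maps X 3 T"
        "h = (\<lambda>ts. \<Sum>j=1..m. H j ts)"
      using h unfolding hnorm3_def Inf_less_iff by blast
    from splitting[OF this] show ?thesis
      using True by simp
  next
    case False
    then have M: "0 < ennreal M"
      using M_nonneg by simp
    have "hnorm3 X \<mu> \<tau> (frozen S \<tau> h) / ennreal M \<le> hnorm3 X \<mu> T h"
      unfolding hnorm3_def[of X \<mu> T]
      by (rule Inf_greatest) (use splitting M in \<open>auto intro!: divide_le_posI_ennreal\<close>)
    then have "ennreal M * (hnorm3 X \<mu> \<tau> (frozen S \<tau> h) / ennreal M)
        \<le> ennreal M * hnorm3 X \<mu> T h"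
      by (rule mult_left_mono) simp
    then show ?thesis
      using M by (simp add: ennreal_times_divide mult.commute[of "ennreal M"] ennreal_mult_divide_eq)
  qed
qed

lemma frozen_hoelder:
  assumes "h \<in> hoelder3 X \<mu> T" "0 \<le> \<tau>" "\<tau> \<le> T"
  shows "frozen S \<tau> h \<in> hoelder3 X \<mu> \<tau>"
proof -
  have "hnorm3 X \<mu> \<tau> (frozen S \<tau> h) < \<infinity>"
    using hnorm3_frozen[OF assms] assms(1)
    by (auto simp: hoelder3_def ennreal_mult_less_top intro: le_less_trans)
  then show ?thesis
    using assms frozen_cont_maps by (auto simp: hoelder3_def)
qed

text \<open>
  Continuity at \<open>h\<close> is tested on \<open>k\<close> at a finite distance from \<open>h\<close>. That distance is the norm of
  \<open>k - h\<close>, so no splitting of the difference has to be constructed.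
\<close>

lemma hatZC3_diff:
  assumes h: "h \<in> hatZC3 X S \<mu> T" and k: "k \<in> hatZC3 X S \<mu> T"
    and "hnorm3 X \<mu> T (\<lambda>ts. k ts - h ts) < \<infinity>"
  shows "(\<lambda>ts. k ts - h ts) \<in> hatZC3 X S \<mu> T"
proof -
  have hc: "h \<in> cont_maps X 3 T" and kc: "k \<in> cont_maps X 3 T"
    using h k by (auto simp: hatZC3_def hoelder3_def)
  have "hat_delta S 3 T (\<lambda>ts. k ts - h ts) ts = hat_delta S 3 T k ts - hat_delta S 3 T h ts" for ts
  proof (cases "ts \<in> time_simplex 4 T")
    case True
    then obtain t u v s where ts: "ts = [t, u, v, s]"
      by (auto simp: time_simplex_def numeral_eq_Suc length_Suc_conv)
    have "u \<le> t"
      using True time_simplex_4_iff unfolding ts by auto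
    then show ?thesis
      using True cont_maps_vecs[OF space hc] cont_maps_vecs[OF space kc]
      by (simp add: hat_delta_def on_simplex_def ts delta_diff S_diff algebra_simps)
  qed (simp add: hat_delta_def)
  then show ?thesis
    using assms cont_maps_diff[OF space kc hc] by (simp add: hatZC3_def hoelder3_def fun_eq_iff)
qed

section \<open>Restriction and transport of frozen primitives\<close>

lemma q_res_frozen:
  assumes r: "r \<in> primitives X \<tau> (frozen S \<tau> h)" and \<tau>: "\<tau>' \<le> \<tau>"
  shows "q_res X \<tau>' (primitives X \<tau> (frozen S \<tau> h))
    = primitives X \<tau>' (on_simplex 3 \<tau>' (frozen S \<tau> h))"
proof -
  have "zc_class X \<tau>' (on_simplex 2 \<tau>' p) = primitives X \<tau>' (on_simplex 3 \<tau>' (frozen S \<tau> h))"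
    if p: "p \<in> primitives X \<tau> (frozen S \<tau> h)" for p
  proof (rule zc_class_primitive[OF space])
    have "delta 2 \<tau>' (on_simplex 2 \<tau>' p) = on_simplex 3 \<tau>' (frozen S \<tau> h)"
    proof (rule delta_2_eqI)
      fix t u s :: real
      assume ord: "0 \<le> s" "s \<le> u" "u \<le> t" "t \<le> \<tau>'"
      have "p [t, s] - p [t, u] - p [u, s] = frozen S \<tau> h [t, u, s]"
        using p delta_2[of s u t \<tau> p] ord \<tau> by (simp add: primitives_def)
      then show "on_simplex 2 \<tau>' p [t, s] - on_simplex 2 \<tau>' p [t, u] - on_simplex 2 \<tau>' p [u, s]
          = on_simplex 3 \<tau>' (frozen S \<tau> h) [t, u, s]"
        using ord by (simp add: time_simplex_2_iff time_simplex_3_iff)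
    qed simp
    then show "on_simplex 2 \<tau>' p \<in> primitives X \<tau>' (on_simplex 3 \<tau>' (frozen S \<tau> h))"
      using p \<tau> by (auto simp: primitives_def intro: cont_maps_restrict)
  qed
  then show ?thesis
    using r unfolding q_res_def by blast
qed

text \<open>
  Transporting by \<open>S (\<tau> - \<tau>')\<close> changes the freezing time from \<open>\<tau>'\<close> to \<open>\<tau>\<close>, because
  \<open>S (\<tau> - \<tau>') S (\<tau>' - t) = S (\<tau> - t)\<close>.
\<close>

lemma q_transport_frozen:
  assumes r: "r \<in> primitives X \<tau>' (frozen S \<tau>' h)" and \<tau>: "0 \<le> \<tau>'" "\<tau>' \<le> \<tau>" "\<tau> \<le> T"
    and h: "h \<in> cont_maps X 3 T"
  shows "q_transport X S \<tau> \<tau>' (primitives X \<tau>' (frozen S \<tau>' h))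
    = primitives X \<tau>' (on_simplex 3 \<tau>' (frozen S \<tau> h))"
proof -
  have "zc_class X \<tau>' (on_simplex 2 \<tau>' (\<lambda>ts. S (\<tau> - \<tau>') (p ts)))
      = primitives X \<tau>' (on_simplex 3 \<tau>' (frozen S \<tau> h))"
    if p: "p \<in> primitives X \<tau>' (frozen S \<tau>' h)" for p
  proof (rule zc_class_primitive[OF space])
    let ?q = "on_simplex 2 \<tau>' (\<lambda>ts. S (\<tau> - \<tau>') (p ts))"
    have pc: "p \<in> cont_maps X 2 \<tau>'"
      using p by (simp add: primitives_def)
    have "delta 2 \<tau>' ?q = on_simplex 3 \<tau>' (frozen S \<tau> h)"
    proof (rule delta_2_eqI)
      fix t u s :: real
      assume ord: "0 \<le> s" "s \<le> u" "u \<le> t" "t \<le> \<tau>'"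
      note pv = cont_maps_vecs[OF space pc]
      have "p [t, s] - p [t, u] - p [u, s] = S (\<tau>' - t) (h [t, u, s])"
        using p delta_2[of s u t \<tau>' p] ord by (simp add: primitives_def frozen_apply)
      then have "S (\<tau> - \<tau>') (p [t, s] - p [t, u] - p [u, s]) = S (\<tau> - t) (h [t, u, s])"
        using ord \<tau> cont_maps_vecs[OF space h] by (simp add: S_compose)
      then show "?q [t, s] - ?q [t, u] - ?q [u, s] = on_simplex 3 \<tau>' (frozen S \<tau> h) [t, u, s]"
        using ord \<tau> pv
        by (simp add: time_simplex_2_iff time_simplex_3_iff frozen_apply S_diff banach_diff[OF space])
    qed simp
    moreover have "?q \<in> cont_maps X 2 \<tau>'"
      using \<tau> by (intro cont_maps_semigroup[OF pc]) auto
    ultimately show "?q \<in> primitives X \<tau>' (on_simplex 3 \<tau>' (frozen S \<tau> h))"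
      by (simp add: primitives_def)
  qed
  then show ?thesis
    using r unfolding q_transport_def by blast
qed

end

section \<open>Sewing the frozen increments\<close>

lemma sewing_remainder_add:
  assumes "low_regularity_sewing T X \<gamma> K J" "\<tau> \<in> {0..T}" "A \<in> sewable X \<gamma> \<tau>" "A' \<in> sewable X \<gamma> \<tau>"
  shows "sewing_remainder J \<tau> (\<lambda>ts. A ts + A' ts)
    = (\<lambda>ts. sewing_remainder J \<tau> A ts + sewing_remainder J \<tau> A' ts)"
  unfolding sewing_remainder_def low_regularity_sewing.add[OF assms] delta_add
  by (simp add: algebra_simps)

lemma sewing_remainder_scale:
  assumes "low_regularity_sewing T X \<gamma> K J" "\<tau> \<in> {0..T}" "A \<in> sewable X \<gamma> \<tau>"
  shows "sewing_remainder J \<tau> (\<lambda>ts. c *\<^sub>R A ts) = (\<lambda>ts. c *\<^sub>R sewing_remainder J \<tau> A ts)"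
  by (simp add: sewing_remainder_def low_regularity_sewing.scale[OF assms] delta_scale
      scaleR_diff_right)

locale frozen_sewing =
  bounded_semigroup T X S + low_regularity_sewing T X \<gamma> K J
  for T :: real and X :: "'a::real_vector nspace" and S and \<gamma> K :: real and J +
  assumes constant_nonneg: "0 \<le> K"
begin

abbreviation frozen_germ :: "real \<Rightarrow> (real list \<Rightarrow> 'a) \<Rightarrow> real list \<Rightarrow> 'a" where
  "frozen_germ \<tau> h \<equiv> on_simplex 2 \<tau> (\<lambda>ts. - frozen S \<tau> h (ts @ [0]))"

lemma frozen_remainder_germ: "frozen_remainder S J \<tau> h = sewing_remainder J \<tau> (frozen_germ \<tau> h)"
  by (simp add: frozen_remainder_def dyadic_Lambda_def)

lemma delta_frozen_germ:
  assumes "h \<in> hatZC3 X S \<gamma> T" "\<tau> \<in> {0..T}"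
  shows "delta 2 \<tau> (frozen_germ \<tau> h) = frozen S \<tau> h"
  using assms
  by (intro delta_closed_primitive frozen_closed) (auto simp: frozen_def hatZC3_def hoelder3_def)

lemma frozen_germ_sewable:
  assumes h: "h \<in> hatZC3 X S \<gamma> T" and \<tau>: "\<tau> \<in> {0..T}"
  shows "frozen_germ \<tau> h \<in> sewable X \<gamma> \<tau>"
proof -
  have hh: "h \<in> hoelder3 X \<gamma> T" "h \<in> cont_maps X 3 T"
    using h by (auto simp: hatZC3_def hoelder3_def)
  have "frozen S \<tau> h \<in> cont_maps X (Suc 2) \<tau>"
    using frozen_cont_maps[OF hh(2)] \<tau> by (simp add: numeral_eq_Suc)
  then have "frozen_germ \<tau> h \<in> cont_maps X 2 \<tau>"
    using \<tau> by (intro cont_maps_append_zero[OF space]) auto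
  then show ?thesis
    using frozen_hoelder[OF hh(1)] \<tau> by (simp add: sewable_def delta_frozen_germ[OF h \<tau>])
qed

lemma frozen_remainder_hoelder:
  assumes "h \<in> hatZC3 X S \<gamma> T" "\<tau> \<in> {0..T}"
  shows "frozen_remainder S J \<tau> h \<in> hoelder2 X \<gamma> \<tau>"
  using remainder_hoelder[OF assms(2) frozen_germ_sewable[OF assms]]
  by (simp add: frozen_remainder_germ)

lemma frozen_remainder_primitive:
  assumes "h \<in> hatZC3 X S \<gamma> T" "\<tau> \<in> {0..T}"
  shows "frozen_remainder S J \<tau> h \<in> primitives X \<tau> (frozen S \<tau> h)"
  using frozen_remainder_hoelder[OF assms]
    remainder_delta[OF assms(2) frozen_germ_sewable[OF assms]]
  by (simp add: primitives_def hoelder2_def delta_frozen_germ[OF assms] frozen_remainder_germ)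

lemma frozen_remainder_bound:
  assumes h: "h \<in> hatZC3 X S \<gamma> T" and \<tau>: "\<tau> \<in> {0..T}"
  shows "hnorm2 X \<gamma> \<tau> (frozen_remainder S J \<tau> h) \<le> ennreal (K * M) * hnorm3 X \<gamma> T h"
proof -
  have "hnorm2 X \<gamma> \<tau> (frozen_remainder S J \<tau> h) \<le> ennreal K * hnorm3 X \<gamma> \<tau> (frozen S \<tau> h)"
    using remainder_bound[OF \<tau> frozen_germ_sewable[OF h \<tau>]]
    by (simp add: frozen_remainder_germ delta_frozen_germ[OF h \<tau>])
  also have "\<dots> \<le> ennreal K * (ennreal M * hnorm3 X \<gamma> T h)"
    using h \<tau> by (intro mult_left_mono hnorm3_frozen) (auto simp: hatZC3_def)
  finally show ?thesis
    using constant_nonneg M_nonneg by (simp add: ennreal_mult mult.assoc)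
qed

lemma frozen_remainder_add:
  assumes h: "h \<in> hatZC3 X S \<gamma> T" and k: "k \<in> hatZC3 X S \<gamma> T" and \<tau>: "\<tau> \<in> {0..T}"
  shows "frozen_remainder S J \<tau> (\<lambda>ts. h ts + k ts)
    = (\<lambda>ts. frozen_remainder S J \<tau> h ts + frozen_remainder S J \<tau> k ts)"
proof -
  have "frozen_germ \<tau> (\<lambda>ts. h ts + k ts) = (\<lambda>ts. frozen_germ \<tau> h ts + frozen_germ \<tau> k ts)"
    using h k by (simp add: frozen_add hatZC3_def hoelder3_def on_simplex_def fun_eq_iff)
  then show ?thesis
    using sewing_remainder_add[OF low_regularity_sewing_axioms \<tau>]
      frozen_germ_sewable[OF h \<tau>] frozen_germ_sewable[OF k \<tau>]
    by (simp add: frozen_remainder_germ)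
qed

lemma frozen_remainder_scale:
  assumes h: "h \<in> hatZC3 X S \<gamma> T" and \<tau>: "\<tau> \<in> {0..T}"
  shows "frozen_remainder S J \<tau> (\<lambda>ts. c *\<^sub>R h ts) = (\<lambda>ts. c *\<^sub>R frozen_remainder S J \<tau> h ts)"
proof -
  have "frozen_germ \<tau> (\<lambda>ts. c *\<^sub>R h ts) = (\<lambda>ts. c *\<^sub>R frozen_germ \<tau> h ts)"
    using h by (simp add: frozen_scale hatZC3_def hoelder3_def on_simplex_def fun_eq_iff)
  then show ?thesis
    using sewing_remainder_scale[OF low_regularity_sewing_axioms \<tau> frozen_germ_sewable[OF h \<tau>]]
    by (simp add: frozen_remainder_germ)
qed

section \<open>The quotient-valued sewing map\<close>

abbreviation \<Lambda> :: "(real list \<Rightarrow> 'a) \<Rightarrow> 'a qfamily" where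
  "\<Lambda> \<equiv> hat_Lambda_q T X S J"

lemma Lambda_eq_primitives:
  assumes "h \<in> hatZC3 X S \<gamma> T" "\<tau> \<in> {0..T}"
  shows "\<Lambda> h \<tau> = primitives X \<tau> (frozen S \<tau> h)"
  using zc_class_primitive[OF space frozen_remainder_primitive[OF assms]] assms(2)
  by (simp add: hat_Lambda_q_def)

lemma Lambda_bound:
  assumes h: "h \<in> hatZC3 X S \<gamma> T"
  shows "fr_norm T X \<gamma> (\<Lambda> h) \<le> ennreal (K * M) * hnorm3 X \<gamma> T h"
  unfolding fr_norm_def
proof (rule SUP_least)
  fix \<tau> assume \<tau>: "\<tau> \<in> {0..T}"
  have "qseminorm X \<gamma> \<tau> (\<Lambda> h \<tau>) \<le> hnorm2 X \<gamma> \<tau> (frozen_remainder S J \<tau> h)"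
    unfolding qseminorm_def
    using frozen_remainder_primitive[OF h \<tau>] frozen_remainder_hoelder[OF h \<tau>]
    by (intro INF_lower) (simp add: Lambda_eq_primitives[OF h \<tau>])
  then show "qseminorm X \<gamma> \<tau> (\<Lambda> h \<tau>) \<le> ennreal (K * M) * hnorm3 X \<gamma> T h"
    using frozen_remainder_bound[OF h \<tau>] by (rule order_trans)
qed

lemma Lambda_in_fr_space:
  assumes h: "h \<in> hatZC3 X S \<gamma> T"
  shows "\<Lambda> h \<in> fr_space T X S \<gamma>"
proof -
  have hc: "h \<in> cont_maps X 3 T" and "hnorm3 X \<gamma> T h < \<infinity>"
    using h by (auto simp: hatZC3_def hoelder3_def)
  then have "fr_norm T X \<gamma> (\<Lambda> h) < \<infinity>"
    using Lambda_bound[OF h] by (auto simp: ennreal_mult_less_top intro: le_less_trans)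
  moreover have "\<Lambda> h \<tau> \<in> qspace X \<gamma> \<tau>" if \<tau>: "\<tau> \<in> {0..T}" for \<tau>
    using primitives_in_quotient[OF space frozen_remainder_primitive[OF h \<tau>]]
      frozen_remainder_primitive[OF h \<tau>] frozen_remainder_hoelder[OF h \<tau>]
    by (auto simp: qspace_def Lambda_eq_primitives[OF h \<tau>])
  moreover have "q_res X \<tau>' (\<Lambda> h \<tau>) = q_transport X S \<tau> \<tau>' (\<Lambda> h \<tau>')"
    if "0 \<le> \<tau>'" "\<tau>' \<le> \<tau>" "\<tau> \<le> T" for \<tau> \<tau>'
  proof -
    have \<tau>: "\<tau> \<in> {0..T}" "\<tau>' \<in> {0..T}"
      using that by auto
    show ?thesis
      using q_res_frozen[OF frozen_remainder_primitive[OF h \<tau>(1)] that(2)]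
        q_transport_frozen[OF frozen_remainder_primitive[OF h \<tau>(2)] that hc]
      unfolding Lambda_eq_primitives[OF h \<tau>(1)] Lambda_eq_primitives[OF h \<tau>(2)] by simp
  qed
  ultimately show ?thesis
    by (auto simp: fr_space_def hat_Lambda_q_def)
qed

lemma Lambda_add:
  assumes h: "h \<in> hatZC3 X S \<gamma> T" and k: "k \<in> hatZC3 X S \<gamma> T"
  shows "\<Lambda> (\<lambda>ts. h ts + k ts) = fr_add T X (\<Lambda> h) (\<Lambda> k)"
proof -
  have "zc_class X \<tau> (frozen_remainder S J \<tau> (\<lambda>ts. h ts + k ts)) = q_add X \<tau> (\<Lambda> h \<tau>) (\<Lambda> k \<tau>)"
    if \<tau>: "\<tau> \<in> {0..T}" for \<tau>
  proof -
    note ph = frozen_remainder_primitive[OF h \<tau>] and pk = frozen_remainder_primitive[OF k \<tau>]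
    have "(\<lambda>ts. frozen_remainder S J \<tau> h ts + frozen_remainder S J \<tau> k ts)
        \<in> primitives X \<tau> (\<lambda>ts. frozen S \<tau> h ts + frozen S \<tau> k ts)"
      using ph pk by (auto simp: primitives_def delta_add intro: cont_maps_add[OF space])
    from zc_class_primitive[OF space this] show ?thesis
      using q_add_primitives[OF space ph pk]
      by (simp add: frozen_remainder_add[OF h k \<tau>] Lambda_eq_primitives[OF _ \<tau>] h k)
  qed
  then show ?thesis
    by (simp add: hat_Lambda_q_def[of T X S J "\<lambda>ts. h ts + k ts"] fr_add_def cong: restrict_cong)
qed

lemma Lambda_scale:
  assumes h: "h \<in> hatZC3 X S \<gamma> T"
  shows "\<Lambda> (\<lambda>ts. c *\<^sub>R h ts) = fr_scale T X c (\<Lambda> h)"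
proof -
  have "zc_class X \<tau> (frozen_remainder S J \<tau> (\<lambda>ts. c *\<^sub>R h ts)) = q_scale X \<tau> c (\<Lambda> h \<tau>)"
    if \<tau>: "\<tau> \<in> {0..T}" for \<tau>
  proof -
    note ph = frozen_remainder_primitive[OF h \<tau>]
    have "(\<lambda>ts. c *\<^sub>R frozen_remainder S J \<tau> h ts) \<in> primitives X \<tau> (\<lambda>ts. c *\<^sub>R frozen S \<tau> h ts)"
      using ph by (auto simp: primitives_def delta_scale intro: cont_maps_scale[OF space])
    from zc_class_primitive[OF space this] show ?thesis
      using q_scale_primitives[OF space ph]
      by (simp add: frozen_remainder_scale[OF h \<tau>] Lambda_eq_primitives[OF h \<tau>])
  qed
  then show ?thesis
    by (simp add: hat_Lambda_q_def[of T X S J "\<lambda>ts. c *\<^sub>R h ts"] fr_scale_def cong: restrict_cong)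
qed

text \<open>
  Comparing the sets of primitives settles this directly: both sides consist of the primitives of
  the frozen increment of \<open>k - h\<close>.
\<close>

lemma Lambda_diff:
  assumes h: "h \<in> hatZC3 X S \<gamma> T" and k: "k \<in> hatZC3 X S \<gamma> T"
    and kh: "(\<lambda>ts. k ts - h ts) \<in> hatZC3 X S \<gamma> T"
  shows "fr_add T X (\<Lambda> k) (fr_scale T X (- 1) (\<Lambda> h)) = \<Lambda> (\<lambda>ts. k ts - h ts)"
proof -
  have hc: "h \<in> cont_maps X 3 T" and kc: "k \<in> cont_maps X 3 T"
    using h k by (auto simp: hatZC3_def hoelder3_def)
  have "q_add X \<tau> (\<Lambda> k \<tau>) (q_scale X \<tau> (- 1) (\<Lambda> h \<tau>)) = \<Lambda> (\<lambda>ts. k ts - h ts) \<tau>"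
    if \<tau>: "\<tau> \<in> {0..T}" for \<tau>
  proof -
    note ph = frozen_remainder_primitive[OF h \<tau>] and pk = frozen_remainder_primitive[OF k \<tau>]
    have "frozen S \<tau> (\<lambda>ts. k ts - h ts) = (\<lambda>ts. frozen S \<tau> k ts + (- 1) *\<^sub>R frozen S \<tau> h ts)"
      using frozen_add[OF kc cont_maps_scale[OF space hc, of "- 1"], of \<tau>]
        frozen_scale[OF hc, of \<tau> "- 1"]
      by simp
    moreover have "(\<lambda>ts. (- 1) *\<^sub>R frozen_remainder S J \<tau> h ts)
        \<in> primitives X \<tau> (\<lambda>ts. (- 1) *\<^sub>R frozen S \<tau> h ts)"
      using ph delta_scale[of 2 \<tau> "- 1" "frozen_remainder S J \<tau> h"]
        cont_maps_scale[OF space, of "frozen_remainder S J \<tau> h" 2 \<tau> "- 1"]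
      by (simp add: primitives_def)
    ultimately show ?thesis
      using q_add_primitives[OF space pk] q_scale_primitives[OF space ph, of "- 1"]
      by (simp add: Lambda_eq_primitives[OF _ \<tau>] h k kh)
  qed
  then show ?thesis
    by (auto simp: fr_add_def fr_scale_def hat_Lambda_q_def restrict_def fun_eq_iff)
qed

lemma Lambda_continuous:
  assumes h: "h \<in> hatZC3 X S \<gamma> T" and "0 < e"
  shows "\<exists>d>0. \<forall>k\<in>hatZC3 X S \<gamma> T. hnorm3 X \<gamma> T (\<lambda>ts. k ts - h ts) < ennreal d \<longrightarrow>
    fr_norm T X \<gamma> (fr_add T X (\<Lambda> k) (fr_scale T X (- 1) (\<Lambda> h))) < ennreal e"
proof (intro exI conjI ballI impI)
  have KM: "0 \<le> K * M"
    using constant_nonneg M_nonneg by simp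
  \<comment> \<open>The summand 1 covers the case \<open>K M = 0\<close> and makes the final inequality strict.\<close>
  let ?d = "e / (K * M + 1)"
  show "0 < ?d"
    using KM \<open>0 < e\<close> by simp
  fix k assume k: "k \<in> hatZC3 X S \<gamma> T" and close: "hnorm3 X \<gamma> T (\<lambda>ts. k ts - h ts) < ennreal ?d"
  have kh: "(\<lambda>ts. k ts - h ts) \<in> hatZC3 X S \<gamma> T"
    using close by (intro hatZC3_diff[OF h k]) (auto intro: less_trans)
  have "fr_norm T X \<gamma> (\<Lambda> (\<lambda>ts. k ts - h ts))
      \<le> ennreal (K * M) * hnorm3 X \<gamma> T (\<lambda>ts. k ts - h ts)"
    by (rule Lambda_bound[OF kh])
  also have "\<dots> \<le> ennreal (K * M) * ennreal ?d"
    using close by (intro mult_left_mono) auto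
  also have "\<dots> = ennreal (K * M * ?d)"
    using KM \<open>0 < ?d\<close> by (intro ennreal_mult[symmetric]) auto
  also have "\<dots> < ennreal e"
    using KM \<open>0 < e\<close> by (intro ennreal_lessI) (auto simp: field_simps)
  finally show "fr_norm T X \<gamma> (fr_add T X (\<Lambda> k) (fr_scale T X (- 1) (\<Lambda> h))) < ennreal e"
    by (simp add: Lambda_diff[OF h k kh])
qed

end

theorem theorem5p4:
  fixes T \<gamma> K :: real
  assumes "0 < T" and "0 < \<gamma>" and "\<gamma> < 1" and "0 \<le> K"
  shows "\<exists>C>0. \<forall>(B :: real \<Rightarrow> 'a::real_vector nspace) S \<alpha> J.
    analytic_scale T B S \<longrightarrow> low_regularity_sewing T (B \<alpha>) \<gamma> K J \<longrightarrow>
    (let Z = hatZC3 (B \<alpha>) S \<gamma> T; \<Lambda> = hat_Lambda_q T (B \<alpha>) S J in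
      \<comment> \<open>well-defined\<close>
      (\<forall>h\<in>Z. \<Lambda> h \<in> fr_space T (B \<alpha>) S \<gamma>) \<and>
      \<comment> \<open>linear\<close>
      (\<forall>h\<in>Z. \<forall>k\<in>Z. \<Lambda> (\<lambda>ts. h ts + k ts) = fr_add T (B \<alpha>) (\<Lambda> h) (\<Lambda> k)) \<and>
      (\<forall>c. \<forall>h\<in>Z. \<Lambda> (\<lambda>ts. c *\<^sub>R h ts) = fr_scale T (B \<alpha>) c (\<Lambda> h)) \<and>
      \<comment> \<open>continuous\<close>
      (\<forall>h\<in>Z. \<forall>e>0. \<exists>d>0. \<forall>k\<in>Z. hnorm3 (B \<alpha>) \<gamma> T (\<lambda>ts. k ts - h ts) < ennreal d \<longrightarrow>
         fr_norm T (B \<alpha>) \<gamma> (fr_add T (B \<alpha>) (\<Lambda> k) (fr_scale T (B \<alpha>) (- 1) (\<Lambda> h))) < ennreal e) \<and>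
      \<comment> \<open>(1)\<close>
      (\<forall>h\<in>Z. \<forall>\<tau>\<in>{0..T}. \<forall>r\<in>\<Lambda> h \<tau>. delta 2 \<tau> r = frozen S \<tau> h) \<and>
      \<comment> \<open>(2)\<close>
      (\<forall>h\<in>Z. \<forall>s u t. 0 \<le> s \<and> s \<le> u \<and> u \<le> t \<and> t \<le> T \<longrightarrow>
         (\<forall>r\<in>\<Lambda> h t. delta 2 t r [t, u, s] = h [t, u, s])) \<and>
      \<comment> \<open>(3)\<close>
      (\<forall>h\<in>Z. fr_norm T (B \<alpha>) \<gamma> (\<Lambda> h)
         \<le> ennreal (C * semigroup_bound T (B \<alpha>) S) * hnorm3 (B \<alpha>) \<gamma> T h))"
proof -
  have claim: "let Z = hatZC3 (B \<alpha>) S \<gamma> T; \<Lambda> = hat_Lambda_q T (B \<alpha>) S J in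
      (\<forall>h\<in>Z. \<Lambda> h \<in> fr_space T (B \<alpha>) S \<gamma>) \<and>
      (\<forall>h\<in>Z. \<forall>k\<in>Z. \<Lambda> (\<lambda>ts. h ts + k ts) = fr_add T (B \<alpha>) (\<Lambda> h) (\<Lambda> k)) \<and>
      (\<forall>c. \<forall>h\<in>Z. \<Lambda> (\<lambda>ts. c *\<^sub>R h ts) = fr_scale T (B \<alpha>) c (\<Lambda> h)) \<and>
      (\<forall>h\<in>Z. \<forall>e>0. \<exists>d>0. \<forall>k\<in>Z. hnorm3 (B \<alpha>) \<gamma> T (\<lambda>ts. k ts - h ts) < ennreal d \<longrightarrow>
         fr_norm T (B \<alpha>) \<gamma> (fr_add T (B \<alpha>) (\<Lambda> k) (fr_scale T (B \<alpha>) (- 1) (\<Lambda> h))) < ennreal e) \<and>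
      (\<forall>h\<in>Z. \<forall>\<tau>\<in>{0..T}. \<forall>r\<in>\<Lambda> h \<tau>. delta 2 \<tau> r = frozen S \<tau> h) \<and>
      (\<forall>h\<in>Z. \<forall>s u t. 0 \<le> s \<and> s \<le> u \<and> u \<le> t \<and> t \<le> T \<longrightarrow>
         (\<forall>r\<in>\<Lambda> h t. delta 2 t r [t, u, s] = h [t, u, s])) \<and>
      (\<forall>h\<in>Z. fr_norm T (B \<alpha>) \<gamma> (\<Lambda> h)
         \<le> ennreal ((K + 1) * semigroup_bound T (B \<alpha>) S) * hnorm3 (B \<alpha>) \<gamma> T h)"
    if scale: "analytic_scale T B S" and sewing: "low_regularity_sewing T (B \<alpha>) \<gamma> K J"
    for B :: "real \<Rightarrow> 'a nspace" and S \<alpha> J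
  proof -
    have "bounded_semigroup T (B \<alpha>) S"
      using \<open>0 < T\<close> analytic_scale.banach[OF scale, of \<alpha>] analytic_scale.analytic[OF scale, of \<alpha>]
        analytic_scale.semigroup_bound_finite[OF scale, of \<alpha>]
      by unfold_locales (auto simp: analytic_semigroup_def)
    then interpret frozen_sewing T "B \<alpha>" S \<gamma> K J
      using sewing \<open>0 \<le> K\<close> by (simp add: frozen_sewing_def frozen_sewing_axioms_def)
    have primitive: "delta 2 \<tau> r = frozen S \<tau> h"
      if "h \<in> hatZC3 (B \<alpha>) S \<gamma> T" "\<tau> \<in> {0..T}" "r \<in> \<Lambda> h \<tau>" for h \<tau> r
      using that by (simp add: Lambda_eq_primitives primitives_def)
    \<comment> \<open>Freezing at the final time \<open>t\<close> itself applies \<open>S\<^sub>0 = Id\<close>.\<close>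
    have unfrozen: "delta 2 t r [t, u, s] = h [t, u, s]"
      if "h \<in> hatZC3 (B \<alpha>) S \<gamma> T" "0 \<le> s \<and> s \<le> u \<and> u \<le> t \<and> t \<le> T" "r \<in> \<Lambda> h t" for h s u t r
      using that primitive[of h t r] cont_maps_vecs[OF space, of h 3 T "[t, u, s]"]
      by (simp add: frozen_apply S_0 hatZC3_def hoelder3_def)
    have bound: "fr_norm T (B \<alpha>) \<gamma> (\<Lambda> h) \<le> ennreal ((K + 1) * M) * hnorm3 (B \<alpha>) \<gamma> T h"
      if h: "h \<in> hatZC3 (B \<alpha>) S \<gamma> T" for h
    proof -
      have "ennreal (K * M) \<le> ennreal ((K + 1) * M)"
        using M_nonneg by (intro ennreal_leI) (simp add: mult_right_mono)
      then have "ennreal (K * M) * hnorm3 (B \<alpha>) \<gamma> T h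
          \<le> ennreal ((K + 1) * M) * hnorm3 (B \<alpha>) \<gamma> T h"
        by (rule mult_right_mono) simp
      with Lambda_bound[OF h] show ?thesis
        by (rule order_trans)
    qed
    show ?thesis
      unfolding Let_def
      by (intro conjI ballI allI impI;
          rule Lambda_in_fr_space Lambda_add Lambda_scale Lambda_continuous primitive unfrozen bound;
          assumption)
  qed
  \<comment> \<open>The sewing constant \<open>K\<close> may be 0, so \<open>K + 1\<close> serves as a positive constant.\<close>
  show ?thesis
  proof (intro exI[of _ "K + 1"] conjI allI impI)
    show "0 < K + 1"
      using \<open>0 \<le> K\<close> by simp
  qed (rule claim)
qed

end
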